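(* Let ${\mathscr X}$ be a second countable metrizable space with countable basis ${\mathscr U}$, and let $\alpha_m=\{A_\varepsilon:\varepsilon\in{\mathscr E}_m\}$, $m\ge0$, be a dyadic tree of Borel partitions generated by ${\mathscr U}$ ($A_{\emptyset}={\mathscr X}$, $A_\varepsilon=A_{\varepsilon0}\cup A_{\varepsilon1}$ disjointly) that resolves ${\mathscr X}$. Let $\{\beta_\varepsilon\}\subset(0,\infty)$ define Pólya tree histogram distributions $\Pi_{\alpha_m}$, and assume there is a Borel probability measure on $M^1({\mathscr X})$ with the tight topology projecting to all $\Pi_{\alpha_m}$ (so the mean histograms are projections of a Borel probability measure $G$). If $$\sup_{m\ge1}\sum_{\varepsilon=e_1\cdots e_m\in{\mathscr E}_m}\prod_{l=1}^m\frac{1}{\beta_{\varepsilon_{l-1}0}+\beta_{\varepsilon_{l-1}1}}\Bigl(\frac{\beta_{\hat\varepsilon_l}}{\beta_{\varepsilon_{l-1}0}+\beta_{\varepsilon_{l-1}1}+1}+\beta_{\varepsilon_l}\Bigr)<\infty,$$ then there exists a unique Radon probability measure $\Pi$ on $M^1({\mathscr X})$ with the weak topology projecting to $\Pi_{\alpha_m}$ for all $m\ge1$; moreover $\Pi(\{P:P\ll G\})=1$.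
   Context: ${\mathscr E}_m$: binary strings of length $m$; ${\mathscr E}=\bigcup_m{\mathscr E}_m$; for $\varepsilon=e_1\cdots e_m$, $\varepsilon_l=e_1\cdots e_l$ ($\varepsilon_0$ empty) and $\hat\varepsilon_l=e_1\cdots e_{l-1}(1-e_l)$. A partition is generated by ${\mathscr U}$ if each of its sets is a finite union of finite intersections of sets $U$ or ${\mathscr X}\setminus U$, $U\in{\mathscr U}$; resolving means the partition sets generate the Borel $\sigma$-algebra. Pólya tree histograms: independent $V_{\varepsilon0}\sim\mathrm{Beta}(\beta_{\varepsilon0},\beta_{\varepsilon1})$, $V_{\varepsilon1}=1-V_{\varepsilon0}$, $P(A_{e_1\cdots e_m})=\prod_{l=1}^mV_{e_1\cdots e_l}$, and $\Pi_{\alpha_m}$ is the law of $(P(A_\varepsilon))_{\varepsilon\in{\mathscr E}_m}$. Tight topology: via bounded continuous functions; weak topology: via bounded Borel functions. $G$ is the mean measure $G(A)=\int P(A)\,d\Pi(P)$. *)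

theory Defs
  imports "HOL-Probability.Probability"
begin

text \<open>Binary strings e_1...e_m are represented as bool lists (False = 0, True = 1).\<close>

definition strings :: "nat \<Rightarrow> bool list set" where
  "strings m = {\<epsilon>. length \<epsilon> = m}"

definition generated_by :: "'a set set \<Rightarrow> 'a set \<Rightarrow> bool" where
  "generated_by \<U> S \<longleftrightarrow>
     (\<exists>F. finite F \<and> (\<forall>C\<in>F. finite C \<and> (\<forall>L\<in>C. L \<in> \<U> \<or> (\<exists>V\<in>\<U>. L = - V)))
          \<and> S = (\<Union>C\<in>F. \<Inter>C))"

definition dyadic_partition_tree :: "'a set set \<Rightarrow> (bool list \<Rightarrow> 'a set) \<Rightarrow> bool" where
  "dyadic_partition_tree \<U> A \<longleftrightarrow>
     A [] = UNIV \<and>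
     (\<forall>\<epsilon>. A \<epsilon> = A (\<epsilon> @ [False]) \<union> A (\<epsilon> @ [True]) \<and> A (\<epsilon> @ [False]) \<inter> A (\<epsilon> @ [True]) = {}) \<and>
     (\<forall>\<epsilon>. generated_by \<U> (A \<epsilon>))"

definition resolves :: "(bool list \<Rightarrow> 'a::topological_space set) \<Rightarrow> bool" where
  "resolves A \<longleftrightarrow> sigma_sets UNIV (range A) = sets borel"

definition beta_measure :: "real \<Rightarrow> real \<Rightarrow> real measure" where
  "beta_measure a b = density lborel
     (\<lambda>x. ennreal (indicator {0<..<1} x * x powr (a - 1) * (1 - x) powr (b - 1) / Beta a b))"

text \<open>Independent V_{eps0} ~ Beta(beta_{eps0}, beta_{eps1}) for |eps| < m (V_{eps1} = 1 - V_{eps0}),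
  and P(A_{e_1...e_m}) = prod_{l=1}^m V_{e_1...e_l}.  The law of the vector
  (P(A_eps))_{eps in E_m} in R^{E_m}.\<close>

definition polya_V :: "(bool list \<Rightarrow> real) \<Rightarrow> bool list \<Rightarrow> real" where
  "polya_V V \<delta> = (if last \<delta> then 1 - V (butlast \<delta>) else V (butlast \<delta>))"

definition polya_hist :: "(bool list \<Rightarrow> real) \<Rightarrow> nat \<Rightarrow> (bool list \<Rightarrow> real) measure" where
  "polya_hist \<beta> m =
     distr (PiM {\<epsilon>. length \<epsilon> < m} (\<lambda>\<epsilon>. beta_measure (\<beta> (\<epsilon> @ [False])) (\<beta> (\<epsilon> @ [True]))))
           (PiM (strings m) (\<lambda>_. borel))
           (\<lambda>V. \<lambda>\<epsilon>\<in>strings m. \<Prod>l\<in>{1..m}. polya_V V (take l \<epsilon>))"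

definition M1 :: "'a::topological_space measure set" where
  "M1 = {P. prob_space P \<and> sets P = sets borel}"

definition tight_topology :: "'a::topological_space measure topology" where
  "tight_topology = topology_generated_by
     {{P \<in> M1. (\<integral>x. f x \<partial>P) \<in> W} | (f :: 'a \<Rightarrow> real) W.
        continuous_on UNIV f \<and> bounded (range f) \<and> open W}"

definition weak_topology :: "'a::topological_space measure topology" where
  "weak_topology = topology_generated_by
     {{P \<in> M1. (\<integral>x. f x \<partial>P) \<in> W} | (f :: 'a \<Rightarrow> real) W.
        f \<in> borel_measurable borel \<and> bounded (range f) \<and> open W}"

definition borel_of_top :: "'b topology \<Rightarrow> 'b measure" where
  "borel_of_top T = sigma (topspace T) {U. openin T U}"

definition borel_prob_on :: "'b topology \<Rightarrow> 'b measure \<Rightarrow> bool" where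
  "borel_prob_on T Q \<longleftrightarrow> prob_space Q \<and> sets Q = sets (borel_of_top T) \<and> space Q = topspace T"

definition radon_prob_on :: "'b topology \<Rightarrow> 'b measure \<Rightarrow> bool" where
  "radon_prob_on T Q \<longleftrightarrow> borel_prob_on T Q \<and>
     (\<forall>B\<in>sets Q. measure Q B = (SUP K\<in>{K. K \<subseteq> B \<and> K \<in> sets Q \<and> compactin T K}. measure Q K))"

definition projects_to :: "'a::topological_space measure measure \<Rightarrow> (bool list \<Rightarrow> 'a set) \<Rightarrow>
    (bool list \<Rightarrow> real) \<Rightarrow> nat \<Rightarrow> bool" where
  "projects_to Q A \<beta> m \<longleftrightarrow>
     distr Q (PiM (strings m) (\<lambda>_. borel)) (\<lambda>P. \<lambda>\<epsilon>\<in>strings m. measure P (A \<epsilon>)) = polya_hist \<beta> m"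

definition mean_measure :: "'a::topological_space measure measure \<Rightarrow> 'a measure" where
  "mean_measure Q = measure_of UNIV (sets borel) (\<lambda>B. \<integral>\<^sup>+ P. emeasure P B \<partial>Q)"

definition polya_sum :: "(bool list \<Rightarrow> real) \<Rightarrow> nat \<Rightarrow> real" where
  "polya_sum \<beta> m = (\<Sum>\<epsilon>\<in>strings m. \<Prod>l\<in>{1..m}.
      (let s = \<beta> (take (l - 1) \<epsilon> @ [False]) + \<beta> (take (l - 1) \<epsilon> @ [True]) in
        1 / s * (\<beta> (take (l - 1) \<epsilon> @ [\<not> \<epsilon> ! (l - 1)]) / (s + 1) + \<beta> (take l \<epsilon>))))"

end

(*
  The sum in the hypothesis is the mean of the "energy" sum_{A in alpha_m} P(A)^2 / G(A), that is of
  the squared L2(G)-norm of the density of P relative to G on the level-m cylinders.  This energy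
  increases with m, so almost every P has bounded energy.  By Cauchy-Schwarz, energy at most R forces
  P(B)^2 <= R G(B) for every Borel set B.  This inequality implies P << G; it makes every additive
  mass assignment of bounded energy countably additive (Caratheodory); and it lets cylinders
  approximate all Borel sets uniformly in P.  Hence P depends weakly continuously on its sequence of
  cylinder masses as long as the energy is at most R, and the law of these masses, which is inner
  regular on a Polish space, pushes forward to a Radon measure.  Cylinder
  masses are continuous and separate measures, so compact sets are determined by their images, which
  gives uniqueness.
*)
theory Submission
  imports Defs
begin

subsection \<open>Cylinders of a dyadic tree\<close>

text \<open>The space is only second countable and metrizable, so compact sets of measures are not
  sought through compact subsets of it. They come from the countable product of reals indexed by
  strings, where \<open>bounded_energy R\<close> is closed. The given law on the tight topology
  cannot simply be transferred: the weak topology is finer, and uncountable unions of weakly open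
  sets may lie outside the sigma-algebra generated by the evaluations P(B). The given law therefore
  serves to supply the joint law of all cylinder masses together with the reference measure G, and
  the new law is the image of that joint law under \<open>realize\<close>, an inverse of
  \<open>coords\<close>. The sum in the hypothesis is a mean energy because its factors are E(V^2) /
  E(V) for the Beta splits V along a path; by independence the products of numerators and
  denominators are E(P(A)^2) and E(P(A)) = G(A). The square matters: it gives one modulus for all P
  at an energy level, whereas P << G alone gives a modulus depending on P and hence no uniform
  limits.\<close>

lemma strings_0 [simp]: "strings 0 = {[]}"
  by (auto simp: strings_def)

lemma finite_strings [simp]: "finite (strings m)"
  using finite_lists_length_eq[of "UNIV :: bool set" m] by (simp add: strings_def)

lemma strings_Suc:
  "strings (Suc m) = (\<lambda>\<epsilon>. \<epsilon> @ [False]) ` strings m \<union> (\<lambda>\<epsilon>. \<epsilon> @ [True]) ` strings m"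
proof (intro equalityI subsetI)
  fix \<epsilon> assume "\<epsilon> \<in> strings (Suc m)"
  then obtain \<delta> b where "\<epsilon> = \<delta> @ [b]" "\<delta> \<in> strings m"
    by (cases \<epsilon> rule: rev_cases) (auto simp: strings_def)
  then show "\<epsilon> \<in> (\<lambda>\<epsilon>. \<epsilon> @ [False]) ` strings m \<union> (\<lambda>\<epsilon>. \<epsilon> @ [True]) ` strings m"
    by (cases b) auto
qed (auto simp: strings_def)

lemma sum_strings_Suc:
  fixes f :: "bool list \<Rightarrow> 'b::comm_monoid_add"
  shows "sum f (strings (Suc m)) = (\<Sum>\<epsilon>\<in>strings m. f (\<epsilon> @ [False]) + f (\<epsilon> @ [True]))"
proof -
  have "sum f (strings (Suc m)) =
      sum f ((\<lambda>\<epsilon>. \<epsilon> @ [False]) ` strings m) + sum f ((\<lambda>\<epsilon>. \<epsilon> @ [True]) ` strings m)"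
    unfolding strings_Suc by (rule sum.union_disjoint) auto
  then show ?thesis
    by (simp add: sum.reindex inj_on_def sum.distrib)
qed

locale dyadic_tree =
  fixes A :: "bool list \<Rightarrow> 'a::topological_space set"
  assumes root: "A [] = UNIV"
    and children_Un: "A \<epsilon> = A (\<epsilon> @ [False]) \<union> A (\<epsilon> @ [True])"
    and disjoint_children: "A (\<epsilon> @ [False]) \<inter> A (\<epsilon> @ [True]) = {}"
    and generates_borel: "sigma_sets UNIV (range A) = sets borel"
begin

lemma cover: "(\<Union>\<epsilon>\<in>strings m. A \<epsilon>) = UNIV"
proof (induction m)
  case (Suc m)
  have "(\<Union>\<epsilon>\<in>strings (Suc m). A \<epsilon>) = (\<Union>\<epsilon>\<in>strings m. A (\<epsilon> @ [False]) \<union> A (\<epsilon> @ [True]))"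
    by (auto simp: strings_Suc)
  also have "\<dots> = (\<Union>\<epsilon>\<in>strings m. A \<epsilon>)" by (simp only: children_Un[symmetric])
  finally show ?case using Suc by simp
qed (simp add: root)

lemma disjoint_level:
  assumes "\<epsilon> \<in> strings m" "\<delta> \<in> strings m" "\<epsilon> \<noteq> \<delta>"
  shows "A \<epsilon> \<inter> A \<delta> = {}"
  using assms
proof (induction m arbitrary: \<epsilon> \<delta>)
  case (Suc m)
  obtain \<epsilon>' a \<delta>' b where eq: "\<epsilon> = \<epsilon>' @ [a]" "\<delta> = \<delta>' @ [b]" "\<epsilon>' \<in> strings m" "\<delta>' \<in> strings m"
    using Suc.prems by (auto simp: strings_Suc)
  have sub: "A \<epsilon> \<subseteq> A \<epsilon>'" "A \<delta> \<subseteq> A \<delta>'"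
    using children_Un[of \<epsilon>'] children_Un[of \<delta>'] by (cases a; cases b; auto simp: eq)+
  show ?case
  proof (cases "\<epsilon>' = \<delta>'")
    case True
    then show ?thesis using Suc.prems disjoint_children[of \<epsilon>'] by (cases a; cases b) (auto simp: eq)
  next
    case False
    then show ?thesis using Suc.IH[OF eq(3,4)] sub by blast
  qed
qed simp

text \<open>Phrased by containment, so that a cylinder does not carry a chosen index set. The
  property persists at finer levels, which lets two cylinders be compared at the larger of their
  levels.\<close>

definition saturated :: "nat \<Rightarrow> 'a set \<Rightarrow> bool" where
  "saturated m B \<longleftrightarrow> (\<forall>\<epsilon>\<in>strings m. A \<epsilon> \<subseteq> B \<or> A \<epsilon> \<inter> B = {})"

definition cylinders :: "'a set set" where
  "cylinders = {B. \<exists>m. saturated m B}"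

lemma saturated_mono:
  assumes "saturated m B" "m \<le> n"
  shows "saturated n B"
  using assms(2,1)
proof (induction n rule: dec_induct)
  case (step n)
  then have *: "A \<epsilon> \<subseteq> B \<or> A \<epsilon> \<inter> B = {}" if "\<epsilon> \<in> strings n" for \<epsilon>
    using that by (auto simp: saturated_def)
  have "A (\<epsilon> @ [b]) \<subseteq> A \<epsilon>" for \<epsilon> b
    using children_Un[of \<epsilon>] by (cases b) auto
  with * have "A (\<epsilon> @ [b]) \<subseteq> B \<or> A (\<epsilon> @ [b]) \<inter> B = {}" if "\<epsilon> \<in> strings n" for \<epsilon> b
    using that by blast
  then show ?case
    by (auto simp: saturated_def strings_Suc)
qed

lemma saturated_A: "saturated (length \<epsilon>) (A \<epsilon>)"
  unfolding saturated_def using disjoint_level[of _ "length \<epsilon>" \<epsilon>]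
  by (auto simp: strings_def)

lemma A_cylinder: "A \<epsilon> \<in> cylinders"
  using saturated_A by (auto simp: cylinders_def)

lemma algebra_cylinders: "algebra UNIV cylinders"
  unfolding algebra_iff_Un
proof (intro conjI ballI)
  show "{} \<in> cylinders" by (auto simp: cylinders_def saturated_def)
next
  fix a assume "a \<in> cylinders"
  then obtain m where "saturated m a" by (auto simp: cylinders_def)
  then have "saturated m (UNIV - a)" by (auto simp: saturated_def)
  then show "UNIV - a \<in> cylinders" by (auto simp: cylinders_def)
next
  fix a b assume "a \<in> cylinders" "b \<in> cylinders"
  then obtain m n where "saturated m a" "saturated n b" by (auto simp: cylinders_def)
  then have "saturated (max m n) a" "saturated (max m n) b"
    by (auto intro: saturated_mono)
  then have "saturated (max m n) (a \<union> b)"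
    unfolding saturated_def by blast
  then show "a \<union> b \<in> cylinders" by (auto simp: cylinders_def)
qed auto

lemma A_borel [measurable]: "A \<epsilon> \<in> sets borel"
  unfolding generates_borel[symmetric] by (rule sigma_sets.Basic) simp

lemma saturated_eq: "saturated m B \<Longrightarrow> B = (\<Union>\<epsilon>\<in>{\<epsilon>\<in>strings m. A \<epsilon> \<subseteq> B}. A \<epsilon>)"
proof -
  assume *: "saturated m B"
  have "x \<in> (\<Union>\<epsilon>\<in>{\<epsilon>\<in>strings m. A \<epsilon> \<subseteq> B}. A \<epsilon>)" if "x \<in> B" for x
  proof -
    have "x \<in> (\<Union>\<epsilon>\<in>strings m. A \<epsilon>)" by (simp add: cover)
    then obtain \<epsilon> where "\<epsilon> \<in> strings m" "x \<in> A \<epsilon>" by auto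
    then show ?thesis using * that by (auto simp: saturated_def)
  qed
  then show ?thesis by auto
qed

lemma cylinders_borel: "B \<in> cylinders \<Longrightarrow> B \<in> sets borel"
proof -
  assume "B \<in> cylinders"
  then obtain m where "saturated m B" by (auto simp: cylinders_def)
  have "(\<Union>\<epsilon>\<in>{\<epsilon>\<in>strings m. A \<epsilon> \<subseteq> B}. A \<epsilon>) \<in> sets borel"
    by (intro sets.finite_UN) auto
  then show ?thesis using saturated_eq[OF \<open>saturated m B\<close>] by simp
qed

lemma sigma_cylinders: "sigma_sets UNIV cylinders = sets borel"
proof
  show "sigma_sets UNIV cylinders \<subseteq> sets borel"
    using cylinders_borel sets.sigma_sets_subset[of cylinders borel] by auto
  show "sets borel \<subseteq> sigma_sets UNIV cylinders"
    unfolding generates_borel[symmetric]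
    by (intro sigma_sets_subseteq) (auto intro: A_cylinder)
qed

lemma measure_cylinder:
  assumes P: "P \<in> M1" and B: "saturated m B"
  shows "measure P B = (\<Sum>\<epsilon>\<in>{\<epsilon>\<in>strings m. A \<epsilon> \<subseteq> B}. measure P (A \<epsilon>))"
proof -
  interpret prob_space P using P by (simp add: M1_def)
  have [simp]: "sets P = sets borel" using P by (simp add: M1_def)
  have "measure P (\<Union>\<epsilon>\<in>{\<epsilon>\<in>strings m. A \<epsilon> \<subseteq> B}. A \<epsilon>) = (\<Sum>\<epsilon>\<in>{\<epsilon>\<in>strings m. A \<epsilon> \<subseteq> B}. measure P (A \<epsilon>))"
    by (intro finite_measure_finite_Union)
       (auto simp: disjoint_family_on_def dest: disjoint_level)
  then show ?thesis using saturated_eq[OF B] by simp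
qed

lemma M1_eqI:
  assumes P: "P \<in> M1" and Q: "Q \<in> M1" and eq: "\<And>\<epsilon>. measure P (A \<epsilon>) = measure Q (A \<epsilon>)"
  shows "P = Q"
proof (rule measure_eqI_generator_eq[where E=cylinders and \<Omega>=UNIV and A="\<lambda>_. UNIV"])
  interpret algebra UNIV cylinders by (rule algebra_cylinders)
  interpret P: prob_space P using P by (simp add: M1_def)
  interpret Q: prob_space Q using Q by (simp add: M1_def)
  show "Int_stable cylinders" by (auto simp: Int_stable_def)
  show "sets P = sigma_sets UNIV cylinders" "sets Q = sigma_sets UNIV cylinders"
    using P Q by (auto simp: sigma_cylinders M1_def)
  show "range (\<lambda>_. UNIV) \<subseteq> cylinders" using top by auto
  show "emeasure P UNIV \<noteq> \<infinity>" using P.emeasure_finite by simp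
  fix X assume "X \<in> cylinders"
  then obtain m where "saturated m X" by (auto simp: cylinders_def)
  then show "emeasure P X = emeasure Q X"
    using P Q eq by (simp add: P.emeasure_eq_measure Q.emeasure_eq_measure measure_cylinder)
qed auto

text \<open>The sets that can be approximated form a sigma-algebra containing the cylinders. A
  single \<open>C\<close> has to serve both measures, because inequalities between P(C) and G(C) are
  later carried over to Borel sets by passing to the limit on both sides.\<close>

lemma approx_by_cylinder:
  assumes G: "G \<in> M1" and P: "P \<in> M1" and B: "B \<in> sets borel" and e: "0 < e"
  shows "\<exists>C\<in>cylinders. measure G (B - C \<union> (C - B)) < e \<and> measure P (B - C \<union> (C - B)) < e"
proof -
  interpret alg: algebra UNIV cylinders by (rule algebra_cylinders)
  interpret P: prob_space P using P by (simp add: M1_def)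
  interpret G: prob_space G using G by (simp add: M1_def)
  have [simp, measurable_cong]: "sets P = sets borel" "sets G = sets borel" using G P by (auto simp: M1_def)
  have [measurable]: "C \<in> sets borel" if "C \<in> cylinders" for C
    using that by (rule cylinders_borel)
  have [simp]: "space P = UNIV" "space G = UNIV"
    using sets_eq_imp_space_eq[of P borel] sets_eq_imp_space_eq[of G borel] by auto
  from B have "B \<in> sigma_sets UNIV cylinders" by (simp add: sigma_cylinders)
  then show ?thesis using e
  proof (induction arbitrary: e rule: sigma_sets.induct)
    case (Basic a)
    then show ?case by (intro bexI[of _ a]) auto
  next
    case Empty
    then show ?case by (intro bexI[of _ "{}"]) auto
  next
    case (Compl a)
    then obtain C where C: "C \<in> cylinders" "measure G (a - C \<union> (C - a)) < e"
        "measure P (a - C \<union> (C - a)) < e" by meson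
    have "UNIV - a - (UNIV - C) \<union> ((UNIV - C) - (UNIV - a)) = a - C \<union> (C - a)" by auto
    then show ?case using C by (intro bexI[of _ "UNIV - C"]) auto
  next
    case (Union a)
    have a[measurable]: "\<And>i. a i \<in> sets borel" using Union.hyps by (simp add: sigma_cylinders)
    have lim: "(\<lambda>N. measure M (\<Union>i<N. a i)) \<longlonglongrightarrow> measure M (\<Union>i. a i)"
      if "prob_space M" "sets M = sets borel" for M :: "'a measure"
    proof -
      interpret M: prob_space M by fact
      have "(\<lambda>N. measure M (\<Union>i<N. a i)) \<longlonglongrightarrow> measure M (\<Union>N. \<Union>i<N. a i)"
        by (rule M.finite_Lim_measure_incseq) (auto simp: that(2) incseq_def intro: order_less_le_trans)
      moreover have "(\<Union>N. \<Union>i<N. a i) = (\<Union>i. a i)" by auto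
      ultimately show ?thesis by simp
    qed
    \<comment> \<open>Half of \<open>e\<close> pays for the tail beyond the first \<open>N\<close>
      sets, with one \<open>N\<close> for both measures; the other half is shared among those
      \<open>N\<close> sets.\<close>
    have "eventually (\<lambda>N. measure G (\<Union>i. a i) - e / 2 < measure G (\<Union>i<N. a i)) sequentially"
      by (rule order_tendstoD(1)[OF lim]) (use \<open>0 < e\<close> G.prob_space_axioms in auto)
    moreover have "eventually (\<lambda>N. measure P (\<Union>i. a i) - e / 2 < measure P (\<Union>i<N. a i)) sequentially"
      by (rule order_tendstoD(1)[OF lim]) (use \<open>0 < e\<close> P.prob_space_axioms in auto)
    ultimately have "eventually (\<lambda>N. measure G (\<Union>i. a i) - e / 2 < measure G (\<Union>i<N. a i) \<and>
        measure P (\<Union>i. a i) - e / 2 < measure P (\<Union>i<N. a i)) sequentially"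
      by eventually_elim simp
    then obtain N where N: "measure G (\<Union>i. a i) - e / 2 < measure G (\<Union>i<N. a i)"
        "measure P (\<Union>i. a i) - e / 2 < measure P (\<Union>i<N. a i)"
      by (auto simp: eventually_sequentially)
    \<comment> \<open>\<open>Suc N\<close> in place of \<open>N\<close> keeps the tolerance positive
      when \<open>N = 0\<close>.\<close>
    have "\<exists>C\<in>cylinders. measure G (a i - C \<union> (C - a i)) < e / (2 * real (Suc N)) \<and>
        measure P (a i - C \<union> (C - a i)) < e / (2 * real (Suc N))" for i
      using Union.IH[of "e / (2 * real (Suc N))" i] \<open>0 < e\<close> by simp
    then obtain C where C: "\<And>i. C i \<in> cylinders"
        "\<And>i. measure G (a i - C i \<union> (C i - a i)) < e / (2 * real (Suc N))"
        "\<And>i. measure P (a i - C i \<union> (C i - a i)) < e / (2 * real (Suc N))"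
      by metis
    define D where "D = (\<Union>i<N. C i)"
    have D: "D \<in> cylinders" unfolding D_def using C(1) by (intro alg.finite_UN) auto
    have bound: "measure M ((\<Union>i. a i) - D \<union> (D - (\<Union>i. a i))) < e"
      if "prob_space M" and [simp]: "sets M = sets borel"
        and N: "measure M (\<Union>i. a i) - e / 2 < measure M (\<Union>i<N. a i)"
        and C': "\<And>i. measure M (a i - C i \<union> (C i - a i)) < e / (2 * real (Suc N))" for M :: "'a measure"
    proof -
      interpret M: prob_space M by fact
      have [measurable]: "C i \<in> sets borel" "D \<in> sets borel" for i using C(1) D by (auto intro: cylinders_borel)
      have "measure M ((\<Union>i. a i) - D \<union> (D - (\<Union>i. a i)))
          \<le> measure M (((\<Union>i. a i) - (\<Union>i<N. a i)) \<union> (\<Union>i<N. a i - C i \<union> (C i - a i)))"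
        by (rule M.finite_measure_mono) (auto simp: D_def)
      also have "\<dots> \<le> measure M ((\<Union>i. a i) - (\<Union>i<N. a i)) + measure M (\<Union>i<N. a i - C i \<union> (C i - a i))"
        by (rule measure_Un_le) auto
      also have "measure M (\<Union>i<N. a i - C i \<union> (C i - a i)) \<le> (\<Sum>i<N. measure M (a i - C i \<union> (C i - a i)))"
        by (rule M.finite_measure_subadditive_finite) auto
      also have "(\<Sum>i<N. measure M (a i - C i \<union> (C i - a i))) \<le> (\<Sum>i<N. e / (2 * real (Suc N)))"
        by (intro sum_mono less_imp_le C')
      also have "\<dots> \<le> e / 2" using \<open>0 < e\<close> by (simp add: field_simps)
      also have "measure M ((\<Union>i. a i) - (\<Union>i<N. a i)) = measure M (\<Union>i. a i) - measure M (\<Union>i<N. a i)"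
        by (rule M.finite_measure_Diff) auto
      finally show ?thesis using N by simp
    qed
    show ?case
      using D bound[OF G.prob_space_axioms _ N(1) C(2)] bound[OF P.prob_space_axioms _ N(2) C(3)]
      by (intro bexI[of _ D]) auto
  qed
qed

end

subsection \<open>Mass assignments of bounded energy\<close>

lemma tendsto_zero_of_square_le:
  fixes f g :: "nat \<Rightarrow> real"
  assumes "\<And>i. (f i)\<^sup>2 \<le> R * g i" "g \<longlonglongrightarrow> 0"
  shows "f \<longlonglongrightarrow> 0"
proof -
  have "(\<lambda>i. sqrt (R * g i)) \<longlonglongrightarrow> sqrt (R * 0)"
    by (intro tendsto_intros assms(2))
  then have "(\<lambda>i. sqrt (R * g i)) \<longlonglongrightarrow> 0" by simp
  moreover have "norm (f i) \<le> sqrt (R * g i)" for i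
    using assms(1)[of i] by (simp add: real_le_rsqrt)
  ultimately show ?thesis
    by (intro Lim_null_comparison[of f "\<lambda>i. sqrt (R * g i)"]) (auto intro: always_eventually)
qed

text \<open>Positivity of every cell gives sense to the quotients in \<open>energy\<close>. It also
  makes all cells nonempty, so that different strings of one level name different cells.\<close>

locale reference_tree = dyadic_tree A for A :: "bool list \<Rightarrow> 'a::topological_space set" +
  fixes G :: "'a measure"
  assumes G_M1: "G \<in> M1" and G_pos: "0 < measure G (A \<epsilon>)"
begin

sublocale G: prob_space G
  using G_M1 by (simp add: M1_def)

lemma sets_G [simp, measurable_cong]: "sets G = sets borel"
  using G_M1 by (simp add: M1_def)

lemma space_G [simp]: "space G = UNIV"
  using sets_eq_imp_space_eq[OF sets_G] by simp

definition energy :: "(bool list \<Rightarrow> real) \<Rightarrow> nat \<Rightarrow> real" where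
  "energy \<theta> m = (\<Sum>\<epsilon>\<in>strings m. (\<theta> \<epsilon>)\<^sup>2 / measure G (A \<epsilon>))"

text \<open>A set of points of the product space, not of measures: every condition concerns finitely
  many coordinates and is closed, so the set is closed for pointwise convergence. That its points
  are mass sequences of measures is proved afterwards.\<close>

definition bounded_energy :: "real \<Rightarrow> (bool list \<Rightarrow> real) set" where
  "bounded_energy R = {\<theta>. \<theta> [] = 1 \<and> (\<forall>\<epsilon>. \<theta> \<epsilon> \<in> {0..1}) \<and>
     (\<forall>\<epsilon>. \<theta> \<epsilon> = \<theta> (\<epsilon> @ [False]) + \<theta> (\<epsilon> @ [True])) \<and> (\<forall>m. energy \<theta> m \<le> R)}"

lemma bounded_energyD:
  assumes "\<theta> \<in> bounded_energy R"
  shows "\<theta> [] = 1" "0 \<le> \<theta> \<epsilon>" "\<theta> \<epsilon> \<le> 1" "\<theta> (\<epsilon> @ [False]) + \<theta> (\<epsilon> @ [True]) = \<theta> \<epsilon>"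
    "energy \<theta> m \<le> R"
proof -
  note * = assms[unfolded bounded_energy_def mem_Collect_eq atLeastAtMost_iff]
  show "\<theta> [] = 1" "energy \<theta> m \<le> R" using * by blast+
  show "0 \<le> \<theta> \<epsilon>" "\<theta> \<epsilon> \<le> 1" using * by blast+
  show "\<theta> (\<epsilon> @ [False]) + \<theta> (\<epsilon> @ [True]) = \<theta> \<epsilon>" using * by metis
qed

text \<open>\<open>smear \<theta> n\<close> spreads each mass \<open>\<theta> \<epsilon>\<close> of level \<open>n\<close> over \<open>A \<epsilon>\<close> proportionally to \<open>G\<close>. It is defined
  on all Borel sets, so its eventually constant limit on cylinders is a well-defined content without
  any choice of a representation of a cylinder as a union.\<close>

definition smear :: "(bool list \<Rightarrow> real) \<Rightarrow> nat \<Rightarrow> 'a set \<Rightarrow> real" where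
  "smear \<theta> n B = (\<Sum>\<epsilon>\<in>strings n. \<theta> \<epsilon> / measure G (A \<epsilon>) * measure G (A \<epsilon> \<inter> B))"

lemma measure_Int_saturated:
  assumes "saturated m B" "\<epsilon> \<in> strings m"
  shows "measure G (A \<epsilon> \<inter> B) = (if A \<epsilon> \<subseteq> B then measure G (A \<epsilon>) else 0)"
proof (cases "A \<epsilon> \<subseteq> B")
  case True
  then show ?thesis by (simp add: Int_absorb2)
next
  case False
  then have "A \<epsilon> \<inter> B = {}" using assms by (auto simp: saturated_def)
  then show ?thesis using False by simp
qed

lemma smear_saturated:
  assumes "saturated m B"
  shows "smear \<theta> m B = (\<Sum>\<epsilon>\<in>{\<epsilon>\<in>strings m. A \<epsilon> \<subseteq> B}. \<theta> \<epsilon>)"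
proof -
  have "smear \<theta> m B = (\<Sum>\<epsilon>\<in>strings m. if A \<epsilon> \<subseteq> B then \<theta> \<epsilon> else 0)"
    unfolding smear_def
  proof (intro sum.cong refl)
    fix \<epsilon> assume "\<epsilon> \<in> strings m"
    then show "\<theta> \<epsilon> / measure G (A \<epsilon>) * measure G (A \<epsilon> \<inter> B) = (if A \<epsilon> \<subseteq> B then \<theta> \<epsilon> else 0)"
      using G_pos[of \<epsilon>] by (subst measure_Int_saturated[OF assms]) auto
  qed
  then show ?thesis by (simp add: sum.inter_filter)
qed

lemma smear_A: "\<epsilon> \<in> strings m \<Longrightarrow> smear \<theta> m (A \<epsilon>) = \<theta> \<epsilon>"
proof -
  assume \<epsilon>: "\<epsilon> \<in> strings m"
  have "\<delta> = \<epsilon>" if "\<delta> \<in> strings m" "A \<delta> \<subseteq> A \<epsilon>" for \<delta>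
  proof (rule ccontr)
    assume "\<delta> \<noteq> \<epsilon>"
    then have "A \<delta> = {}" using disjoint_level[OF that(1) \<epsilon>] that(2) by auto
    then show False using G_pos[of \<delta>] by simp
  qed
  then have "{\<delta>\<in>strings m. A \<delta> \<subseteq> A \<epsilon>} = {\<epsilon>}" using \<epsilon> by auto
  moreover have "saturated m (A \<epsilon>)" using saturated_A[of \<epsilon>] \<epsilon> by (simp add: strings_def)
  ultimately show ?thesis by (simp add: smear_saturated)
qed

lemma smear_Un:
  assumes "B \<in> sets borel" "C \<in> sets borel" "B \<inter> C = {}"
  shows "smear \<theta> n (B \<union> C) = smear \<theta> n B + smear \<theta> n C"
proof -
  have "measure G (A \<epsilon> \<inter> (B \<union> C)) = measure G (A \<epsilon> \<inter> B) + measure G (A \<epsilon> \<inter> C)" for \<epsilon>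
    unfolding Int_Un_distrib using assms by (intro G.finite_measure_Union) auto
  then show ?thesis
    by (simp add: smear_def distrib_left sum.distrib)
qed

lemma smear_Suc:
  assumes "\<theta> \<in> bounded_energy R" "saturated n B"
  shows "smear \<theta> (Suc n) B = smear \<theta> n B"
proof -
  have "smear \<theta> (Suc n) B = (\<Sum>\<epsilon>\<in>strings (Suc n). if A \<epsilon> \<subseteq> B then \<theta> \<epsilon> else 0)"
    using saturated_mono[OF assms(2), of "Suc n"] by (simp add: smear_saturated sum.inter_filter)
  also have "\<dots> = (\<Sum>\<epsilon>\<in>strings n. if A \<epsilon> \<subseteq> B then \<theta> \<epsilon> else 0)"
    unfolding sum_strings_Suc
  proof (intro sum.cong refl)
    fix \<epsilon> assume \<epsilon>: "\<epsilon> \<in> strings n"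
    have ne: "A (\<epsilon> @ [b]) \<noteq> {}" for b
      using G_pos[of "\<epsilon> @ [b]"] by auto
    have sub: "A (\<epsilon> @ [b]) \<subseteq> A \<epsilon>" for b
      using children_Un[of \<epsilon>] by (cases b) auto
    have "A \<epsilon> \<subseteq> B \<or> A \<epsilon> \<inter> B = {}" using assms(2) \<epsilon> by (simp add: saturated_def)
    \<comment> \<open>Nonemptiness of the child is needed for the forward direction: a child inside
      \<open>B\<close> rules out that its parent is disjoint from \<open>B\<close>.\<close>
    then have "A (\<epsilon> @ [b]) \<subseteq> B \<longleftrightarrow> A \<epsilon> \<subseteq> B" for b
      using ne[of b] sub[of b] by blast
    then show "(if A (\<epsilon> @ [False]) \<subseteq> B then \<theta> (\<epsilon> @ [False]) else 0) +
         (if A (\<epsilon> @ [True]) \<subseteq> B then \<theta> (\<epsilon> @ [True]) else 0) = (if A \<epsilon> \<subseteq> B then \<theta> \<epsilon> else 0)"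
      by (simp add: bounded_energyD(4)[OF assms(1)])
  qed
  also have "\<dots> = smear \<theta> n B"
    using assms(2) by (simp add: smear_saturated sum.inter_filter)
  finally show ?thesis .
qed

lemma smear_stable:
  assumes "\<theta> \<in> bounded_energy R" "saturated m B" "m \<le> n"
  shows "smear \<theta> n B = smear \<theta> m B"
  using assms(3)
proof (induction n rule: dec_induct)
  case (step n)
  then show ?case using smear_Suc[OF assms(1) saturated_mono[OF assms(2), of n]] by simp
qed simp

text \<open>Cauchy-Schwarz with the weight 1 / G(A) split evenly between the two factors. One sum of
  squares is the energy; in the other, G(A \<inter> B)^2 / G(A) is at most G(A \<inter> B), and
  these add up to G(B).\<close>

lemma smear_square_le:
  assumes "energy \<theta> n \<le> R" "B \<in> sets borel"
  shows "(smear \<theta> n B)\<^sup>2 \<le> R * measure G B"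
proof -
  let ?g = "\<lambda>\<epsilon>. measure G (A \<epsilon>)"
  have "smear \<theta> n B = (\<Sum>\<epsilon>\<in>strings n. \<theta> \<epsilon> / sqrt (?g \<epsilon>) * (measure G (A \<epsilon> \<inter> B) / sqrt (?g \<epsilon>)))"
    unfolding smear_def using G_pos by (intro sum.cong refl) (simp add: field_simps)
  then have "(smear \<theta> n B)\<^sup>2 \<le> (\<Sum>\<epsilon>\<in>strings n. (\<theta> \<epsilon> / sqrt (?g \<epsilon>))\<^sup>2) * (\<Sum>\<epsilon>\<in>strings n. (measure G (A \<epsilon> \<inter> B) / sqrt (?g \<epsilon>))\<^sup>2)"
    by (simp only: Cauchy_Schwarz_ineq_sum)
  also have "(\<Sum>\<epsilon>\<in>strings n. (\<theta> \<epsilon> / sqrt (?g \<epsilon>))\<^sup>2) = energy \<theta> n"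
    unfolding energy_def using G_pos by (intro sum.cong refl) (simp add: power_divide less_imp_le)
  also have "energy \<theta> n * (\<Sum>\<epsilon>\<in>strings n. (measure G (A \<epsilon> \<inter> B) / sqrt (?g \<epsilon>))\<^sup>2)
      \<le> R * (\<Sum>\<epsilon>\<in>strings n. measure G (A \<epsilon> \<inter> B))"
  proof (intro mult_mono sum_mono assms(1))
    show "0 \<le> R" using assms(1) by (rule order_trans[rotated]) (auto simp: energy_def intro!: sum_nonneg)
    show "0 \<le> (\<Sum>\<epsilon>\<in>strings n. (measure G (A \<epsilon> \<inter> B) / sqrt (?g \<epsilon>))\<^sup>2)"
      by (intro sum_nonneg) auto
    fix \<epsilon>
    have le: "measure G (A \<epsilon> \<inter> B) \<le> ?g \<epsilon>" by (rule G.finite_measure_mono) auto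
    have "(measure G (A \<epsilon> \<inter> B) / sqrt (?g \<epsilon>))\<^sup>2 = measure G (A \<epsilon> \<inter> B) * (measure G (A \<epsilon> \<inter> B) / ?g \<epsilon>)"
      by (simp add: power_divide power2_eq_square)
    also have "\<dots> \<le> measure G (A \<epsilon> \<inter> B) * 1"
      using le G_pos[of \<epsilon>] by (intro mult_left_mono) auto
    finally show "(measure G (A \<epsilon> \<inter> B) / sqrt (?g \<epsilon>))\<^sup>2 \<le> measure G (A \<epsilon> \<inter> B)" by simp
  qed
  also have "(\<Sum>\<epsilon>\<in>strings n. measure G (A \<epsilon> \<inter> B)) = measure G (\<Union>\<epsilon>\<in>strings n. A \<epsilon> \<inter> B)"
  proof (rule G.finite_measure_finite_Union[symmetric])
    show "disjoint_family_on (\<lambda>\<epsilon>. A \<epsilon> \<inter> B) (strings n)"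
      unfolding disjoint_family_on_def using disjoint_level[of _ n] by blast
  qed (use assms(2) in auto)
  also have "(\<Union>\<epsilon>\<in>strings n. A \<epsilon> \<inter> B) = B"
    using arg_cong[OF cover[of n], of "\<lambda>X. X \<inter> B"] by simp
  finally show ?thesis .
qed

lemma smear_nonneg: "(\<And>\<epsilon>. 0 \<le> \<theta> \<epsilon>) \<Longrightarrow> 0 \<le> smear \<theta> n B"
  unfolding smear_def by (intro sum_nonneg mult_nonneg_nonneg divide_nonneg_nonneg measure_nonneg)

text \<open>The critical point is continuity at the empty set: without compactness, decreasing
  cylinders with empty intersection need not become empty. But G is already countably additive, so
  their G-measure tends to 0, and the square bound forces the content to follow.\<close>

lemma ex_M1_with_masses:
  assumes \<theta>: "\<theta> \<in> bounded_energy R"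
  shows "\<exists>P\<in>M1. \<forall>\<epsilon>. measure P (A \<epsilon>) = \<theta> \<epsilon>"
proof -
  interpret alg: algebra UNIV cylinders by (rule algebra_cylinders)
  define f where "f B = lim (\<lambda>n. smear \<theta> n B)" for B
  have f: "f B = smear \<theta> m B" if "saturated m B" for m B
  proof -
    have "eventually (\<lambda>n. smear \<theta> n B = smear \<theta> m B) sequentially"
      using eventually_ge_at_top[of m] by eventually_elim (rule smear_stable[OF \<theta> that])
    then show ?thesis unfolding f_def by (intro limI tendsto_eventually)
  qed
  have nonneg: "0 \<le> \<theta> \<epsilon>" for \<epsilon> by (rule bounded_energyD[OF \<theta>])
  have f_nonneg: "0 \<le> f B" if B: "B \<in> cylinders" for B
  proof -
    obtain m where "saturated m B" using B by (auto simp: cylinders_def)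
    then show ?thesis using smear_nonneg[of \<theta>, OF nonneg] by (simp add: f)
  qed
  have f_square: "(f B)\<^sup>2 \<le> R * measure G B" if B: "B \<in> cylinders" for B
  proof -
    obtain m where "saturated m B" using B by (auto simp: cylinders_def)
    moreover have "energy \<theta> m \<le> R" by (rule bounded_energyD[OF \<theta>])
    ultimately show ?thesis using smear_square_le[OF _ cylinders_borel[OF B]] by (simp add: f)
  qed
  have "\<exists>\<mu>. (\<forall>s\<in>cylinders. \<mu> s = ennreal (f s)) \<and> measure_space UNIV (sigma_sets UNIV cylinders) \<mu>"
  proof (rule alg.caratheodory_empty_continuous)
    show "positive cylinders (\<lambda>s. ennreal (f s))"
      using f[of 0 "{}"] by (auto simp: positive_def saturated_def smear_def)
    show "additive cylinders (\<lambda>s. ennreal (f s))"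
      unfolding additive_def
    proof (intro ballI impI)
      fix x y assume xy: "x \<in> cylinders" "y \<in> cylinders" "x \<inter> y = {}"
      then obtain m n where "saturated m x" "saturated n y" by (auto simp: cylinders_def)
      then have sat: "saturated (max m n) x" "saturated (max m n) y"
        by (auto intro: saturated_mono)
      then have "saturated (max m n) (x \<union> y)" unfolding saturated_def by blast
      then have "f (x \<union> y) = f x + f y"
        using sat xy by (simp add: f smear_Un cylinders_borel)
      then show "ennreal (f (x \<union> y)) = ennreal (f x) + ennreal (f y)"
        using f_nonneg xy by simp
    qed
    show "ennreal (f B) \<noteq> \<infinity>" for B by simp
    fix B :: "nat \<Rightarrow> 'a set" assume B: "range B \<subseteq> cylinders" "decseq B" "(\<Inter>i. B i) = {}"
    have "(\<lambda>i. measure G (B i)) \<longlonglongrightarrow> measure G (\<Inter>i. B i)"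
      using B cylinders_borel by (intro G.finite_Lim_measure_decseq) auto
    then have lim: "(\<lambda>i. measure G (B i)) \<longlonglongrightarrow> 0" using B(3) by simp
    have "(f (B i))\<^sup>2 \<le> R * measure G (B i)" for i
      using B(1) by (intro f_square) blast
    then have "(\<lambda>i. f (B i)) \<longlonglongrightarrow> 0"
      using lim by (rule tendsto_zero_of_square_le)
    then have "(\<lambda>i. ennreal (f (B i))) \<longlonglongrightarrow> ennreal 0"
      by (rule tendsto_ennrealI)
    then show "(\<lambda>i. ennreal (f (B i))) \<longlonglongrightarrow> 0" by simp
  qed
  then obtain \<mu> where \<mu>: "\<And>s. s \<in> cylinders \<Longrightarrow> \<mu> s = ennreal (f s)"
      "measure_space UNIV (sigma_sets UNIV cylinders) \<mu>" by auto
  define P where "P = measure_of UNIV (sets borel) \<mu>"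
  have [simp]: "sets P = sets borel"
    unfolding P_def using sets.sigma_sets_eq[of "borel :: 'a measure"] by (simp add: sets_measure_of_conv del: sets.sigma_sets_eq)
  have em: "emeasure P B = \<mu> B" if "B \<in> sets borel" for B
    by (rule emeasure_measure_of[OF P_def])
       (use \<mu>(2) that in \<open>auto simp: measure_space_def sigma_cylinders\<close>)
  have f_A: "f (A \<epsilon>) = \<theta> \<epsilon>" for \<epsilon>
    using f[OF saturated_A] by (simp add: smear_A strings_def)
  have "measure P (A \<epsilon>) = \<theta> \<epsilon>" for \<epsilon>
    using nonneg by (simp add: measure_def em \<mu>(1) A_cylinder f_A)
  moreover have "prob_space P"
  proof
    have "emeasure P (A []) = ennreal (\<theta> [])"
      by (simp add: em \<mu>(1) A_cylinder f_A)
    then show "emeasure P (space P) = 1"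
      using \<theta> sets_eq_imp_space_eq[of P borel] by (simp add: root bounded_energyD(1))
  qed
  ultimately show ?thesis by (intro bexI[of _ P]) (auto simp: M1_def)
qed

end

subsection \<open>Weakly continuous dependence on the cylinder masses\<close>

lemma topspace_weak [simp]: "topspace (weak_topology :: 'a::topological_space measure topology) = M1"
proof -
  let ?S = "{{P \<in> M1. (\<integral>x. f x \<partial>P) \<in> W} | (f :: 'a \<Rightarrow> real) W.
        f \<in> borel_measurable borel \<and> bounded (range f) \<and> open W}"
  have "{P \<in> M1. (\<integral>x. 0 \<partial>P) \<in> (UNIV :: real set)} \<in> ?S"
    by (intro CollectI exI[of _ "\<lambda>_. 0"] exI[of _ UNIV]) auto
  then have "\<Union>?S = M1" by blast
  then show ?thesis unfolding weak_topology_def by simp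
qed

lemma M1D: "P \<in> M1 \<Longrightarrow> sets P = sets borel" "P \<in> M1 \<Longrightarrow> space P = UNIV" "P \<in> M1 \<Longrightarrow> prob_space P"
  using sets_eq_imp_space_eq[of P borel] by (auto simp: M1_def)

lemma abs_measure_diff_le:
  assumes P: "P \<in> M1" and [measurable]: "B \<in> sets borel" "C \<in> sets borel"
  shows "\<bar>measure P B - measure P C\<bar> \<le> measure P (B - C \<union> (C - B))"
proof -
  interpret prob_space P by (rule M1D[OF P])
  have [measurable_cong, simp]: "sets P = sets borel" by (rule M1D[OF P])
  have "measure P B \<le> measure P (C \<union> (B - C \<union> (C - B)))" by (rule finite_measure_mono) auto
  also have "\<dots> \<le> measure P C + measure P (B - C \<union> (C - B))" by (rule measure_Un_le) auto
  finally have 1: "measure P B \<le> measure P C + measure P (B - C \<union> (C - B))" .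
  have "measure P C \<le> measure P (B \<union> (B - C \<union> (C - B)))" by (rule finite_measure_mono) auto
  also have "\<dots> \<le> measure P B + measure P (B - C \<union> (C - B))" by (rule measure_Un_le) auto
  finally show ?thesis using 1 by simp
qed

section \<open>Cylinder masses as coordinates on the space of probability measures\<close>

context dyadic_tree
begin

definition coords :: "'a measure \<Rightarrow> bool list \<Rightarrow> real" where
  "coords P \<epsilon> = measure P (A \<epsilon>)"

lemma coords_additive:
  assumes "P \<in> M1"
  shows "coords P \<epsilon> = coords P (\<epsilon> @ [False]) + coords P (\<epsilon> @ [True])"
proof -
  interpret prob_space P by (rule M1D[OF assms])
  have "measure P (A (\<epsilon> @ [False]) \<union> A (\<epsilon> @ [True])) = coords P (\<epsilon> @ [False]) + coords P (\<epsilon> @ [True])"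
    unfolding coords_def using disjoint_children[of \<epsilon>]
    by (intro finite_measure_Union) (auto simp: M1D[OF assms])
  then show ?thesis
    unfolding coords_def[of P \<epsilon>] by (subst children_Un)
qed

end

context reference_tree
begin

text \<open>The choice is harmless: the masses of all cells determine a measure in \<open>M1\<close>
  by \<open>M1_eqI\<close>. At a \<open>\<theta>\<close> that is not the mass sequence of any
  measure the value is unspecified.\<close>

definition realize :: "(bool list \<Rightarrow> real) \<Rightarrow> 'a measure" where
  "realize \<theta> = (SOME P. P \<in> M1 \<and> coords P = \<theta>)"

lemma realize:
  assumes "\<theta> \<in> bounded_energy R"
  shows realize_M1: "realize \<theta> \<in> M1" and coords_realize: "coords (realize \<theta>) = \<theta>"
proof -
  have "\<exists>P. P \<in> M1 \<and> coords P = \<theta>"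
    using ex_M1_with_masses[OF assms] by (auto simp: coords_def fun_eq_iff)
  from someI_ex[OF this] show "realize \<theta> \<in> M1" "coords (realize \<theta>) = \<theta>"
    unfolding realize_def by auto
qed

lemma coords_bounded_energy:
  assumes P: "P \<in> M1" and "\<And>m. energy (coords P) m \<le> R"
  shows "coords P \<in> bounded_energy R"
proof -
  interpret prob_space P by (rule M1D[OF P])
  have "coords P [] = 1"
    using prob_space by (simp add: coords_def root M1D[OF P])
  moreover have "coords P \<epsilon> \<in> {0..1}" for \<epsilon>
    by (simp add: coords_def)
  ultimately show ?thesis
    unfolding bounded_energy_def using assms(2) coords_additive[OF P] by blast
qed

lemma realize_coords:
  assumes "P \<in> M1" "coords P \<in> bounded_energy R"
  shows "realize (coords P) = P"
  using realize[OF assms(2)] assms(1) by (intro M1_eqI) (auto simp: coords_def fun_eq_iff)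

lemma measure_eq_smear:
  assumes "P \<in> M1" "saturated m C"
  shows "measure P C = smear (coords P) m C"
  using assms by (simp add: measure_cylinder smear_saturated coords_def)

text \<open>On cylinders this is \<open>smear_square_le\<close>. For a Borel set, cylinders
  \<open>C n\<close> converging to it for P and for G at the same time carry the inequality to the
  limit. The factor \<open>R\<close> depends on P only through its energy level.\<close>

lemma measure_square_le:
  assumes P: "P \<in> M1" and en: "coords P \<in> bounded_energy R" and B: "B \<in> sets borel"
  shows "(measure P B)\<^sup>2 \<le> R * measure G B"
proof -
  have "\<exists>C\<in>cylinders. measure G (B - C \<union> (C - B)) < inverse (real (Suc n)) \<and>
      measure P (B - C \<union> (C - B)) < inverse (real (Suc n))" for n
    using approx_by_cylinder[OF G_M1 P B] by simp
  then obtain C where C: "\<And>n. C n \<in> cylinders"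
      "\<And>n. measure G (B - C n \<union> (C n - B)) < inverse (real (Suc n))"
      "\<And>n. measure P (B - C n \<union> (C n - B)) < inverse (real (Suc n))"
    by metis
  have C_borel: "C n \<in> sets borel" for n using C(1) by (rule cylinders_borel)
  have lim: "(\<lambda>n. measure M (C n)) \<longlonglongrightarrow> measure M B"
    if "M \<in> M1" "\<And>n. measure M (B - C n \<union> (C n - B)) < inverse (real (Suc n))" for M
  proof (rule LIM_zero_cancel, rule Lim_null_comparison[OF _ LIMSEQ_inverse_real_of_nat])
    have "norm (measure M (C n) - measure M B) \<le> inverse (real (Suc n))" for n
      using abs_measure_diff_le[OF that(1) B C_borel[of n]] that(2)[of n] by simp
    then show "\<forall>\<^sub>F n in sequentially. norm (measure M (C n) - measure M B) \<le> inverse (real (Suc n))"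
      by simp
  qed
  have "(measure P (C n))\<^sup>2 \<le> R * measure G (C n)" for n
  proof -
    obtain m where m: "saturated m (C n)" using C(1)[of n] by (auto simp: cylinders_def)
    show ?thesis
      unfolding measure_eq_smear[OF P m]
      by (rule smear_square_le[OF bounded_energyD(5)[OF en] C_borel])
  qed
  then show ?thesis
    by (intro LIMSEQ_le[of "\<lambda>n. (measure P (C n))\<^sup>2" _ "\<lambda>n. R * measure G (C n)"] tendsto_intros
        lim[OF P C(3)] lim[OF G_M1 C(2)]) auto
qed

text \<open>On a cylinder the mass is a finite linear combination of coordinates, hence continuous.
  A Borel set is approximated in G, and the square bound turns the G-error 1/(n+1) into an error of
  at most sqrt(R/(n+1)) for all \<open>\<theta>\<close> at once, so a uniform limit of continuous
  functions results.\<close>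

lemma continuous_measure_realize:
  assumes B: "B \<in> sets borel"
  shows "continuous_on (bounded_energy R) (\<lambda>\<theta>. measure (realize \<theta>) B)"
proof -
  \<comment> \<open>G takes both roles here: the approximating cylinders must not depend on
    \<open>\<theta>\<close>.\<close>
  have "\<exists>C\<in>cylinders. measure G (B - C \<union> (C - B)) < inverse (real (Suc n))" for n
    using approx_by_cylinder[OF G_M1 G_M1 B] by simp
  then obtain C where C: "\<And>n. C n \<in> cylinders"
      "\<And>n. measure G (B - C n \<union> (C n - B)) < inverse (real (Suc n))"
    by metis
  have C_borel: "C n \<in> sets borel" for n using C(1) by (rule cylinders_borel)
  have est: "\<bar>measure (realize \<theta>) (C n) - measure (realize \<theta>) B\<bar> \<le> sqrt (R * inverse (real (Suc n)))"
    if \<theta>: "\<theta> \<in> bounded_energy R" for \<theta> n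
  proof -
    let ?D = "B - C n \<union> (C n - B)"
    have D: "?D \<in> sets borel" using B C_borel by auto
    have "0 \<le> energy \<theta> 0" by (simp add: energy_def)
    then have "0 \<le> R" using bounded_energyD(5)[OF \<theta>, of 0] by linarith
    have "(measure (realize \<theta>) ?D)\<^sup>2 \<le> R * measure G ?D"
      using D \<theta> by (intro measure_square_le) (auto simp: realize)
    also have "\<dots> \<le> R * inverse (real (Suc n))"
      using C(2)[of n] \<open>0 \<le> R\<close> by (intro mult_left_mono) auto
    finally have "measure (realize \<theta>) ?D \<le> sqrt (R * inverse (real (Suc n)))"
      by (rule real_le_rsqrt)
    then show ?thesis
      using abs_measure_diff_le[OF realize_M1[OF \<theta>] B C_borel[of n]] by simp
  qed
  have "(\<lambda>n. sqrt (R * inverse (real (Suc n)))) \<longlonglongrightarrow> sqrt (R * 0)"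
    by (intro tendsto_intros LIMSEQ_inverse_real_of_nat)
  then have lim: "(\<lambda>n. sqrt (R * inverse (real (Suc n)))) \<longlonglongrightarrow> 0" by simp
  have "uniform_limit (bounded_energy R) (\<lambda>n \<theta>. measure (realize \<theta>) (C n)) (\<lambda>\<theta>. measure (realize \<theta>) B) sequentially"
  proof (rule uniform_limitI)
    fix e :: real assume "0 < e"
    from order_tendstoD(2)[OF lim this]
    show "\<forall>\<^sub>F n in sequentially. \<forall>\<theta>\<in>bounded_energy R. dist (measure (realize \<theta>) (C n)) (measure (realize \<theta>) B) < e"
      by eventually_elim (auto simp: dist_real_def intro!: order_le_less_trans[OF est])
  qed
  moreover have "continuous_on (bounded_energy R) (\<lambda>\<theta>. measure (realize \<theta>) (C n))" for n
  proof -
    obtain m where m: "saturated m (C n)" using C(1)[of n] by (auto simp: cylinders_def)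
    have "continuous_on (bounded_energy R) (\<lambda>\<theta>. smear \<theta> m (C n))"
      unfolding smear_def
      by (intro continuous_intros continuous_on_subset[OF continuous_on_product_coordinates])
         (use G_pos in \<open>auto simp: less_imp_neq[symmetric]\<close>)
    then show ?thesis
      by (rule continuous_on_eq) (simp add: measure_eq_smear[OF realize_M1 m] coords_realize)
  qed
  ultimately show ?thesis
    by (intro uniform_limit_theorem[of _ "\<lambda>n \<theta>. measure (realize \<theta>) (C n)"]) auto
qed

text \<open>Rounding \<open>f\<close> down to multiples of 1/(n+1) gives a function with finitely
  many values, whose integral is a finite combination of masses of Borel sets. The rounding error is
  the same for every probability measure, so the convergence is uniform in
  \<open>\<theta>\<close>.\<close>

lemma continuous_integral_realize:
  fixes f :: "'a \<Rightarrow> real"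
  assumes f[measurable]: "f \<in> borel_measurable borel" and bdd: "bounded (range f)"
  shows "continuous_on (bounded_energy R) (\<lambda>\<theta>. \<integral>x. f x \<partial>realize \<theta>)"
proof -
  obtain M where M: "\<And>x. \<bar>f x\<bar> \<le> M" using bdd by (auto simp: bounded_iff)
  define E where "E n k = {x. \<lfloor>real (Suc n) * f x\<rfloor> = k}" for n k
  have E[measurable]: "E n k \<in> sets borel" for n k unfolding E_def by measurable
  \<comment> \<open>Since \<open>f\<close> is bounded by \<open>M\<close>, every rounded value has
    its index between \<open>- N n\<close> and \<open>N n\<close>; this is what makes the sum below
    finite.\<close>
  define N where "N n = \<lceil>real (Suc n) * M\<rceil> + 1" for n
  define s where "s n x = (\<Sum>k\<in>{- N n..N n}. real_of_int k / real (Suc n) * indicator (E n k) x)" for n x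
  have s: "s n x = real_of_int \<lfloor>real (Suc n) * f x\<rfloor> / real (Suc n)" for n x
  proof -
    have "\<bar>real (Suc n) * f x\<bar> \<le> real (Suc n) * M"
      using M[of x] by (simp add: abs_mult del: of_nat_Suc)
    then have mem: "\<lfloor>real (Suc n) * f x\<rfloor> \<in> {- N n..N n}"
      unfolding N_def by (simp del: of_nat_Suc) linarith
    have "s n x = (\<Sum>k\<in>{- N n..N n}. if k = \<lfloor>real (Suc n) * f x\<rfloor> then real_of_int k / real (Suc n) else 0)"
      unfolding s_def by (intro sum.cong) (auto simp: E_def)
    then show ?thesis using mem by (simp add: sum.delta)
  qed
  have close: "\<bar>s n x - f x\<bar> \<le> inverse (real (Suc n))" for n x
  proof -
    have "\<bar>real_of_int \<lfloor>real (Suc n) * f x\<rfloor> - real (Suc n) * f x\<bar> \<le> 1" by linarith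
    then have "\<bar>real_of_int \<lfloor>real (Suc n) * f x\<rfloor> - real (Suc n) * f x\<bar> / real (Suc n) \<le> 1 / real (Suc n)"
      by (rule divide_right_mono) simp
    also have "\<bar>real_of_int \<lfloor>real (Suc n) * f x\<rfloor> - real (Suc n) * f x\<bar> / real (Suc n)
      = \<bar>(real_of_int \<lfloor>real (Suc n) * f x\<rfloor> - real (Suc n) * f x) / real (Suc n)\<bar>"
      by (simp del: of_nat_Suc)
    also have "\<dots> = \<bar>s n x - f x\<bar>"
      unfolding s diff_divide_distrib by (simp del: of_nat_Suc)
    finally show ?thesis by (simp add: inverse_eq_divide)
  qed
  have est: "(\<integral>x. s n x \<partial>P) = (\<Sum>k\<in>{- N n..N n}. real_of_int k / real (Suc n) * measure P (E n k))"
      "\<bar>(\<integral>x. s n x \<partial>P) - (\<integral>x. f x \<partial>P)\<bar> \<le> inverse (real (Suc n))" if P: "P \<in> M1" for P n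
  proof -
    interpret prob_space P by (rule M1D[OF P])
    have [measurable_cong, simp]: "sets P = sets borel" by (rule M1D[OF P])
    have int: "integrable P (\<lambda>x. real_of_int k / real (Suc n) * indicator (E n k) x)" for k
      by (intro integrable_mult_right integrable_real_indicator) (auto simp: emeasure_eq_measure)
    show "(\<integral>x. s n x \<partial>P) = (\<Sum>k\<in>{- N n..N n}. real_of_int k / real (Suc n) * measure P (E n k))"
      unfolding s_def by (subst Bochner_Integration.integral_sum[OF int]) (simp add: M1D[OF P])
    have int_s: "integrable P (s n)"
      unfolding s_def by (intro Bochner_Integration.integrable_sum int)
    have int_f: "integrable P f"
      by (intro integrable_const_bound[of _ M]) (auto simp: M)
    have "\<bar>(\<integral>x. s n x \<partial>P) - (\<integral>x. f x \<partial>P)\<bar> = \<bar>\<integral>x. s n x - f x \<partial>P\<bar>"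
      using int_s int_f by simp
    also have "\<dots> \<le> (\<integral>x. \<bar>s n x - f x\<bar> \<partial>P)" by (rule integral_abs_bound)
    also have "\<dots> \<le> (\<integral>x. inverse (real (Suc n)) \<partial>P)"
      using int_s int_f close by (intro integral_mono) auto
    finally show "\<bar>(\<integral>x. s n x \<partial>P) - (\<integral>x. f x \<partial>P)\<bar> \<le> inverse (real (Suc n))"
      using prob_space by simp
  qed
  have "uniform_limit (bounded_energy R) (\<lambda>n \<theta>. \<integral>x. s n x \<partial>realize \<theta>) (\<lambda>\<theta>. \<integral>x. f x \<partial>realize \<theta>) sequentially"
  proof (rule uniform_limitI)
    fix e :: real assume "0 < e"
    from order_tendstoD(2)[OF LIMSEQ_inverse_real_of_nat this]
    show "\<forall>\<^sub>F n in sequentially. \<forall>\<theta>\<in>bounded_energy R. dist (\<integral>x. s n x \<partial>realize \<theta>) (\<integral>x. f x \<partial>realize \<theta>) < e"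
      by eventually_elim (auto simp: dist_real_def intro!: order_le_less_trans[OF est(2)] realize_M1)
  qed
  moreover have "continuous_on (bounded_energy R) (\<lambda>\<theta>. \<integral>x. s n x \<partial>realize \<theta>)" for n
  proof -
    have "continuous_on (bounded_energy R)
        (\<lambda>\<theta>. \<Sum>k\<in>{- N n..N n}. real_of_int k / real (Suc n) * measure (realize \<theta>) (E n k))"
      by (intro continuous_intros continuous_measure_realize E)
    then show ?thesis
      by (rule continuous_on_eq) (simp add: est(1) realize_M1)
  qed
  ultimately show ?thesis
    by (intro uniform_limit_theorem[of _ "\<lambda>n \<theta>. \<integral>x. s n x \<partial>realize \<theta>"]) auto
qed

lemma continuous_map_realize:
  "continuous_map (top_of_set (bounded_energy R)) weak_topology realize"
  unfolding weak_topology_def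
proof (rule continuous_on_generated_topo)
  fix U assume "U \<in> {{P \<in> M1. (\<integral>x. f x \<partial>P) \<in> W} | (f :: 'a \<Rightarrow> real) W.
        f \<in> borel_measurable borel \<and> bounded (range f) \<and> open W}"
  then obtain f :: "'a \<Rightarrow> real" and W where U: "U = {P \<in> M1. (\<integral>x. f x \<partial>P) \<in> W}"
    and f: "f \<in> borel_measurable borel" "bounded (range f)" and W: "open W" by blast
  have "realize -` U \<inter> bounded_energy R = (\<lambda>\<theta>. \<integral>x. f x \<partial>realize \<theta>) -` W \<inter> bounded_energy R"
    using realize_M1[of _ R] by (auto simp: U)
  moreover have "openin (top_of_set (bounded_energy R)) \<dots>"
    using continuous_openin_preimage_gen[OF continuous_integral_realize[OF f] W]
    by (simp add: Int_commute)
  ultimately show "openin (top_of_set (bounded_energy R)) (realize -` U \<inter> topspace (top_of_set (bounded_energy R)))"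
    by simp
next
  have "realize ` bounded_energy R \<subseteq> M1" using realize_M1[of _ R] by auto
  then show "realize ` topspace (top_of_set (bounded_energy R)) \<subseteq> \<Union> {{P \<in> M1. (\<integral>x. f x \<partial>P) \<in> W} | (f :: 'a \<Rightarrow> real) W.
        f \<in> borel_measurable borel \<and> bounded (range f) \<and> open W}"
    using topspace_weak[where 'a='a] unfolding weak_topology_def topology_generated_by_topspace
      topspace_euclidean_subtopology by (simp only:)
qed

lemma closed_bounded_energy: "closed (bounded_energy R)"
proof -
  have "bounded_energy R = {\<theta>. \<theta> [] = 1} \<inter> (\<Inter>\<epsilon>. {\<theta>. 0 \<le> \<theta> \<epsilon>}) \<inter> (\<Inter>\<epsilon>. {\<theta>. \<theta> \<epsilon> \<le> 1}) \<inter>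
      (\<Inter>\<epsilon>. {\<theta>. \<theta> \<epsilon> = \<theta> (\<epsilon> @ [False]) + \<theta> (\<epsilon> @ [True])}) \<inter> (\<Inter>m. {\<theta>. energy \<theta> m \<le> R})"
    unfolding bounded_energy_def set_eq_iff
    by (simp only: mem_Collect_eq Int_iff INT_iff ball_UNIV simp_thms atLeastAtMost_iff all_conj_distrib conj_assoc)
  moreover have "closed \<dots>"
    unfolding energy_def
    by (intro closed_Int closed_INT ballI closed_Collect_le closed_Collect_eq continuous_intros
        continuous_on_product_coordinates) (use G_pos in \<open>auto simp: less_imp_neq[symmetric]\<close>)
  ultimately show ?thesis by simp
qed

end

subsection \<open>Moments of Polya tree histograms\<close>

lemma Beta_real_pos: "0 < a \<Longrightarrow> 0 < b \<Longrightarrow> 0 < Beta a (b :: real)"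
  by (simp add: Beta_def Gamma_real_pos)

lemma sets_beta_measure [simp, measurable_cong]: "sets (beta_measure a b) = sets borel"
  by (simp add: beta_measure_def)

lemma space_beta_measure [simp]: "space (beta_measure a b) = UNIV"
  by (simp add: beta_measure_def)

text \<open>Multiplying the density by x^i (1-x)^j only shifts the two parameters. Both exponents
  are kept because a path uses V at a left step and 1 - V at a right step.\<close>

lemma has_bochner_integral_beta_measure:
  assumes a: "0 < a" and b: "0 < b"
  shows "has_bochner_integral (beta_measure a b) (\<lambda>x. x ^ i * (1 - x) ^ j)
    (Beta (a + real i) (b + real j) / Beta a b)"
  unfolding beta_measure_def
proof (rule has_bochner_integral_density)
  let ?h = "\<lambda>x::real. x powr (a + real i - 1) * (1 - x) powr (b + real j - 1)"
  have "(?h has_integral Beta (a + real i) (b + real j)) {0<..<1}"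
    using has_integral_Beta_real[of "a + real i" "b + real j"] a b
    by (simp add: has_integral_Icc_iff_Ioo)
  then have "(\<integral>\<^sup>+x. ennreal (indicator {0<..<1} x * ?h x) \<partial>lborel) = ennreal (Beta (a + real i) (b + real j))"
    by (intro nn_integral_has_integral_lebesgue) auto
  then have "has_bochner_integral lborel (\<lambda>x. indicator {0<..<1} x * ?h x) (Beta (a + real i) (b + real j))"
    using a b Beta_real_pos[of "a + real i" "b + real j"]
    by (intro has_bochner_integral_nn_integral) (auto intro: less_imp_le)
  then have "has_bochner_integral lborel (\<lambda>x. indicator {0<..<1} x * ?h x / Beta a b)
      (Beta (a + real i) (b + real j) / Beta a b)"
    by (rule has_bochner_integral_divide_zero)
  moreover have "indicator {0<..<1} x * ?h x / Beta a b =
      (indicator {0<..<1} x * x powr (a - 1) * (1 - x) powr (b - 1) / Beta a b) *\<^sub>R (x ^ i * (1 - x) ^ j)"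
    for x :: real
  proof (cases "x \<in> {0<..<1}")
    case True
    then have "x powr (a + real i - 1) = x powr (a - 1) * x ^ i"
      "(1 - x) powr (b + real j - 1) = (1 - x) powr (b - 1) * (1 - x) ^ j"
      using powr_add[of x "a - 1" "real i"] powr_add[of "1 - x" "b - 1" "real j"]
      by (simp_all add: powr_realpow algebra_simps)
    then show ?thesis by simp
  qed simp
  ultimately show "has_bochner_integral lborel
     (\<lambda>x. (indicator {0<..<1} x * x powr (a - 1) * (1 - x) powr (b - 1) / Beta a b) *\<^sub>R (x ^ i * (1 - x) ^ j))
     (Beta (a + real i) (b + real j) / Beta a b)"
    by simp
qed (use a b Beta_real_pos[of a b] in \<open>auto intro: less_imp_le\<close>)

lemma prob_space_beta_measure: "0 < a \<Longrightarrow> 0 < b \<Longrightarrow> prob_space (beta_measure a b)"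
proof
  assume ab: "0 < a" "0 < b"
  have "has_bochner_integral (beta_measure a b) (\<lambda>x. 1 :: real) 1"
    using has_bochner_integral_beta_measure[OF ab, of 0 0] Beta_real_pos[OF ab] by simp
  then have "integrable (beta_measure a b) (\<lambda>x. 1 :: real)" "(\<integral>x. (1 :: real) \<partial>beta_measure a b) = 1"
    by (auto simp: has_bochner_integral_iff)
  then have "(\<integral>\<^sup>+x. ennreal 1 \<partial>beta_measure a b) = ennreal 1"
    by (subst nn_integral_eq_integral) auto
  then show "emeasure (beta_measure a b) (space (beta_measure a b)) = 1"
    by simp
qed

text \<open>Both come from the recurrence (a + b) Beta(a + 1, b) = a Beta(a, b), used once for the
  first moment and twice for the second.\<close>

lemma Beta_moment_ratio:
  assumes "0 < a" "0 < (b::real)"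
  shows "Beta (a + 1) b / Beta a b = a / (a + b)"
    "Beta (a + 2) b / Beta a b = a * (a + 1) / ((a + b) * (a + b + 1))"
proof -
  have "(a + b) * Beta (a + 1) b = a * Beta a b"
    using assms by (intro Beta_plus1_left) (auto elim: nonpos_Ints_cases)
  then have 1: "Beta (a + 1) b = a / (a + b) * Beta a b" using assms by (simp add: field_simps)
  have "((a + 1) + b) * Beta ((a + 1) + 1) b = (a + 1) * Beta (a + 1) b"
    using assms by (intro Beta_plus1_left) (auto elim: nonpos_Ints_cases)
  then have 2: "Beta (a + 2) b = (a + 1) / (a + b + 1) * Beta (a + 1) b"
    using assms by (simp add: field_simps)
  show "Beta (a + 1) b / Beta a b = a / (a + b)"
    unfolding 1 using assms Beta_real_pos[OF assms] by simp
  show "Beta (a + 2) b / Beta a b = a * (a + 1) / ((a + b) * (a + b + 1))"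
    unfolding 2 1 using assms Beta_real_pos[OF assms] by (simp add: ac_simps)
qed

text \<open>The \<open>p\<close>-th moment of the Beta variable by which the path
  \<open>\<epsilon>\<close> passes from its prefix of length \<open>l\<close> to the one of length
  \<open>l + 1\<close>. Levels count from 0 here, whereas the products in \<open>polya_hist\<close>
  and \<open>polya_sum\<close> count from 1.\<close>

definition split_moment :: "(bool list \<Rightarrow> real) \<Rightarrow> nat \<Rightarrow> bool list \<Rightarrow> nat \<Rightarrow> real" where
  "split_moment \<beta> p \<epsilon> l = (\<integral>v. (if \<epsilon> ! l then 1 - v else v) ^ p
     \<partial>beta_measure (\<beta> (take l \<epsilon> @ [False])) (\<beta> (take l \<epsilon> @ [True])))"

lemma split_moment_eq:
  assumes \<beta>: "\<forall>\<epsilon>. \<epsilon> \<noteq> [] \<longrightarrow> \<beta> \<epsilon> > (0::real)" and l: "l < length \<epsilon>"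
  defines "s \<equiv> \<beta> (take l \<epsilon> @ [False]) + \<beta> (take l \<epsilon> @ [True])"
  shows "split_moment \<beta> 1 \<epsilon> l = \<beta> (take (Suc l) \<epsilon>) / s"
    and "split_moment \<beta> 2 \<epsilon> l = \<beta> (take (Suc l) \<epsilon>) * (\<beta> (take (Suc l) \<epsilon>) + 1) / (s * (s + 1))"
proof -
  let ?a = "\<beta> (take l \<epsilon> @ [False])" and ?b = "\<beta> (take l \<epsilon> @ [True])"
  have pos: "0 < ?a" "0 < ?b" using \<beta> by auto
  have mom: "(\<integral>x. x ^ i * (1 - x) ^ j \<partial>beta_measure ?a ?b) = Beta (?a + real i) (?b + real j) / Beta ?a ?b" for i j
    using has_bochner_integral_beta_measure[OF pos] by (rule has_bochner_integral_integral_eq)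
  have take: "take (Suc l) \<epsilon> = take l \<epsilon> @ [\<epsilon> ! l]" using l by (simp add: take_Suc_conv_app_nth)
  have comm: "?b + ?a = s" "?a + ?b = s" by (auto simp: s_def)
  show "split_moment \<beta> 1 \<epsilon> l = \<beta> (take (Suc l) \<epsilon>) / s"
    using mom[of 1 0] mom[of 0 1] Beta_moment_ratio(1)[OF pos] Beta_moment_ratio(1)[OF pos(2,1)]
    unfolding split_moment_def take
    by (cases "\<epsilon> ! l") (simp_all add: Beta_commute[of ?a] comm)
  show "split_moment \<beta> 2 \<epsilon> l = \<beta> (take (Suc l) \<epsilon>) * (\<beta> (take (Suc l) \<epsilon>) + 1) / (s * (s + 1))"
    using mom[of 2 0] mom[of 0 2] Beta_moment_ratio(2)[OF pos] Beta_moment_ratio(2)[OF pos(2,1)]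
    unfolding split_moment_def take
    by (cases "\<epsilon> ! l") (simp_all add: Beta_commute[of ?a] comm)
qed

text \<open>Each step of the path reads the variable attached to one prefix of
  \<open>\<epsilon>\<close>, and prefixes of different length are different indices, so the factors
  are independent and the moment of the product is the product of the moments.\<close>

lemma integral_polya_hist:
  assumes \<beta>: "\<forall>\<epsilon>. \<epsilon> \<noteq> [] \<longrightarrow> \<beta> \<epsilon> > (0::real)" and \<epsilon>: "\<epsilon> \<in> strings m"
  shows "(\<integral>x. (x \<epsilon>) ^ p \<partial>polya_hist \<beta> m) = (\<Prod>l<m. split_moment \<beta> p \<epsilon> l)"
proof -
  define I where "I = {\<delta> :: bool list. length \<delta> < m}"
  define M where "M \<delta> = beta_measure (\<beta> (\<delta> @ [False])) (\<beta> (\<delta> @ [True]))" for \<delta> :: "bool list"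
  define w where "w \<delta> v = (if \<epsilon> ! length \<delta> then 1 - v else v)" for \<delta> :: "bool list" and v :: real
  \<comment> \<open>Padding with 1 off the path writes the product along the path as a product over
    the full index set, the form required by the product integral.\<close>
  define F where "F \<delta> v = (if \<delta> \<in> (\<lambda>l. take l \<epsilon>) ` {..<m} then w \<delta> v ^ p else 1)" for \<delta> v
  have len: "length \<epsilon> = m" using \<epsilon> by (simp add: strings_def)
  have prob_M: "prob_space (M \<delta>)" for \<delta>
    unfolding M_def using \<beta> by (intro prob_space_beta_measure) auto
  interpret product_sigma_finite M
    by (rule product_sigma_finite.intro) (rule prob_space_imp_sigma_finite[OF prob_M])
  have finI: "finite I"
    unfolding I_def using finite_lists_length_le[of "UNIV :: bool set" m]
    by (rule finite_subset[rotated]) auto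
  have sets_M [simp, measurable_cong]: "sets (M \<delta>) = sets borel" for \<delta> by (simp add: M_def)
  have inj: "inj_on (\<lambda>l. take l \<epsilon>) {..<m}"
    by (rule inj_onI) (use len in \<open>metis length_take lessThan_iff min.absorb2 min.commute order_less_imp_le\<close>)
  have int_F: "integrable (M \<delta>) (F \<delta>)" for \<delta>
  proof -
    have pos: "0 < \<beta> (\<delta> @ [False])" "0 < \<beta> (\<delta> @ [True])" using \<beta> by auto
    interpret prob_space "M \<delta>" by (rule prob_M)
    have "integrable (M \<delta>) (\<lambda>v. v ^ i * (1 - v) ^ j)" for i j
      unfolding M_def using has_bochner_integral_beta_measure[OF pos] by (auto simp: has_bochner_integral_iff)
    from this[of p 0] this[of 0 p] show ?thesis
      unfolding F_def w_def
      by (cases "\<delta> \<in> (\<lambda>l. take l \<epsilon>) ` {..<m}"; cases "\<epsilon> ! length \<delta>") (simp_all only: if_True if_False power_0 mult_1 mult_1_right integrable_const finite_measure_axioms)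
  qed
  have prod_F: "(\<Prod>\<delta>\<in>I. c \<delta>) = (\<Prod>l<m. c (take l \<epsilon>))"
    if "\<And>\<delta>. \<delta> \<notin> (\<lambda>l. take l \<epsilon>) ` {..<m} \<Longrightarrow> c \<delta> = 1" for c :: "bool list \<Rightarrow> real"
  proof -
    have "(\<Prod>\<delta>\<in>I. c \<delta>) = (\<Prod>\<delta>\<in>(\<lambda>l. take l \<epsilon>) ` {..<m}. c \<delta>)"
      by (rule prod.mono_neutral_right[OF finI]) (use len that in \<open>auto simp: I_def\<close>)
    then show ?thesis by (simp add: prod.reindex[OF inj])
  qed
  have meas: "(\<lambda>V. \<lambda>\<epsilon>\<in>strings m. \<Prod>l\<in>{1..m}. polya_V V (take l \<epsilon>)) \<in> measurable (PiM I M) (PiM (strings m) (\<lambda>_. borel))"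
  proof (intro measurable_restrict borel_measurable_prod)
    fix \<delta> l assume "\<delta> \<in> strings m" "l \<in> {1..m}"
    then have "butlast (take l \<delta>) \<in> I" by (auto simp: I_def strings_def)
    then have "(\<lambda>V. V (butlast (take l \<delta>))) \<in> measurable (PiM I M) (M (butlast (take l \<delta>)))"
      by (rule measurable_component_singleton)
    then have "(\<lambda>V. V (butlast (take l \<delta>))) \<in> borel_measurable (PiM I M)"
      by (simp add: measurable_cong_sets[OF refl sets_M])
    then show "(\<lambda>V. polya_V V (take l \<delta>)) \<in> borel_measurable (PiM I M)"
      unfolding polya_V_def by (cases "last (take l \<delta>)") simp_all
  qed
  have hist: "polya_hist \<beta> m = distr (PiM I M) (PiM (strings m) (\<lambda>_. borel))
      (\<lambda>V. \<lambda>\<epsilon>\<in>strings m. \<Prod>l\<in>{1..m}. polya_V V (take l \<epsilon>))"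
    by (simp add: polya_hist_def I_def M_def[abs_def])
  have "(\<integral>x. (x \<epsilon>) ^ p \<partial>polya_hist \<beta> m) = (\<integral>V. (\<Prod>l\<in>{1..m}. polya_V V (take l \<epsilon>)) ^ p \<partial>PiM I M)"
    unfolding hist
    by (subst integral_distr[OF meas]) (use \<epsilon> in \<open>simp_all add: borel_measurable_power measurable_component_singleton\<close>)
  also have "\<dots> = (\<integral>V. (\<Prod>\<delta>\<in>I. F \<delta> (V \<delta>)) \<partial>PiM I M)"
  proof (intro Bochner_Integration.integral_cong refl)
    fix V
    \<comment> \<open>The index drops by one because \<open>polya_V\<close> at a string looks up the
      variable of its parent: the factor for the prefix of length \<open>l + 1\<close> reads
      \<open>V\<close> at the prefix of length \<open>l\<close>.\<close>
    have "(\<Prod>l\<in>{1..m}. polya_V V (take l \<epsilon>)) = (\<Prod>l<m. polya_V V (take (Suc l) \<epsilon>))"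
      by (rule prod.reindex_bij_witness[of _ Suc "\<lambda>l. l - 1"]) auto
    also have "\<dots> = (\<Prod>l<m. w (take l \<epsilon>) (V (take l \<epsilon>)))"
      using len by (intro prod.cong) (auto simp: polya_V_def w_def take_Suc_conv_app_nth)
    also have "\<dots> ^ p = (\<Prod>l<m. F (take l \<epsilon>) (V (take l \<epsilon>)))"
      unfolding prod_power_distrib by (intro prod.cong) (auto simp: F_def)
    also have "\<dots> = (\<Prod>\<delta>\<in>I. F \<delta> (V \<delta>))"
      by (rule prod_F[symmetric]) (simp add: F_def)
    finally show "(\<Prod>l\<in>{1..m}. polya_V V (take l \<epsilon>)) ^ p = (\<Prod>\<delta>\<in>I. F \<delta> (V \<delta>))" .
  qed
  also have "\<dots> = (\<Prod>\<delta>\<in>I. integral\<^sup>L (M \<delta>) (F \<delta>))"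
    by (rule product_integral_prod[OF finI int_F])
  also have "\<dots> = (\<Prod>l<m. integral\<^sup>L (M (take l \<epsilon>)) (F (take l \<epsilon>)))"
  proof (rule prod_F)
    fix \<delta> assume "\<delta> \<notin> (\<lambda>l. take l \<epsilon>) ` {..<m}"
    then have "F \<delta> = (\<lambda>_. 1)" by (auto simp: F_def fun_eq_iff)
    then show "integral\<^sup>L (M \<delta>) (F \<delta>) = 1" using prob_space.prob_space[OF prob_M[of \<delta>]] by simp
  qed
  also have "\<dots> = (\<Prod>l<m. split_moment \<beta> p \<epsilon> l)"
    using len by (intro prod.cong) (auto simp: F_def[abs_def] w_def split_moment_def M_def)
  finally show ?thesis .
qed

text \<open>With b the parameter of the chosen child, c that of its sibling and s = b + c, the
  factor in the sum equals (b + 1) / (s + 1). This is the second moment b (b + 1) / (s (s + 1)) of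
  the split divided by its mean b / s.\<close>

lemma polya_sum_eq:
  assumes \<beta>: "\<forall>\<epsilon>. \<epsilon> \<noteq> [] \<longrightarrow> \<beta> \<epsilon> > (0::real)"
  shows "polya_sum \<beta> m =
    (\<Sum>\<epsilon>\<in>strings m. (\<Prod>l<m. split_moment \<beta> 2 \<epsilon> l) / (\<Prod>l<m. split_moment \<beta> 1 \<epsilon> l))"
  unfolding polya_sum_def
proof (intro sum.cong refl)
  fix \<epsilon> assume "\<epsilon> \<in> strings m"
  then have len: "length \<epsilon> = m" by (simp add: strings_def)
  define t where "t l = (let s = \<beta> (take l \<epsilon> @ [False]) + \<beta> (take l \<epsilon> @ [True]) in
        1 / s * (\<beta> (take l \<epsilon> @ [\<not> \<epsilon> ! l]) / (s + 1) + \<beta> (take (Suc l) \<epsilon>)))" for l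
  have "t l = split_moment \<beta> 2 \<epsilon> l / split_moment \<beta> 1 \<epsilon> l" if "l < m" for l
  proof -
    let ?s = "\<beta> (take l \<epsilon> @ [False]) + \<beta> (take l \<epsilon> @ [True])"
    let ?b = "\<beta> (take (Suc l) \<epsilon>)" and ?c = "\<beta> (take l \<epsilon> @ [\<not> \<epsilon> ! l])"
    have l: "l < length \<epsilon>" using that len by simp
    have s: "?s = ?b + ?c" using l by (cases "\<epsilon> ! l") (simp_all add: take_Suc_conv_app_nth)
    have "take (Suc l) \<epsilon> \<noteq> []" using l by (cases \<epsilon>) auto
    then have pos: "0 < ?b" "0 < ?c" using \<beta> by auto
    \<comment> \<open>each factor of the hypothesis is the ratio of the second to the first moment of a split\<close>
    have "1 / (b + c) * (c / (b + c + 1) + b) = b * (b + 1) / ((b + c) * (b + c + 1)) / (b / (b + c))"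
      if "0 < b" "0 < c" for b c :: real
    proof -
      have "c / (b + c + 1) + b = (b + 1) * (b + c) / (b + c + 1)"
        using that by (simp add: field_simps)
      moreover have "b * (b + 1) / ((b + c) * (b + c + 1)) / (b / (b + c)) = (b + 1) / (b + c + 1)"
        using that by (simp add: divide_simps)
      ultimately show ?thesis using that by simp
    qed
    from this[OF pos] show ?thesis
      unfolding t_def Let_def split_moment_eq[OF \<beta> l] s .
  qed
  then have "(\<Prod>l<m. t l) = (\<Prod>l<m. split_moment \<beta> 2 \<epsilon> l) / (\<Prod>l<m. split_moment \<beta> 1 \<epsilon> l)"
    by (simp add: prod_dividef)
  moreover have "(\<Prod>l\<in>{1..m}. t (l - 1)) = (\<Prod>l<m. t l)"
    by (rule prod.reindex_bij_witness[of _ Suc "\<lambda>l. l - 1"]) auto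
  moreover have "(\<Prod>l\<in>{1..m}. let s = \<beta> (take (l - 1) \<epsilon> @ [False]) + \<beta> (take (l - 1) \<epsilon> @ [True]) in
        1 / s * (\<beta> (take (l - 1) \<epsilon> @ [\<not> \<epsilon> ! (l - 1)]) / (s + 1) + \<beta> (take l \<epsilon>))) = (\<Prod>l\<in>{1..m}. t (l - 1))"
    by (intro prod.cong) (auto simp: t_def)
  ultimately show "(\<Prod>l\<in>{1..m}. let s = \<beta> (take (l - 1) \<epsilon> @ [False]) + \<beta> (take (l - 1) \<epsilon> @ [True]) in
        1 / s * (\<beta> (take (l - 1) \<epsilon> @ [\<not> \<epsilon> ! (l - 1)]) / (s + 1) + \<beta> (take l \<epsilon>))) =
      (\<Prod>l<m. split_moment \<beta> 2 \<epsilon> l) / (\<Prod>l<m. split_moment \<beta> 1 \<epsilon> l)"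
    by simp
qed

lemma split_moment_1_pos:
  assumes \<beta>: "\<forall>\<epsilon>. \<epsilon> \<noteq> [] \<longrightarrow> \<beta> \<epsilon> > (0::real)" and l: "l < length \<epsilon>"
  shows "0 < split_moment \<beta> 1 \<epsilon> l"
proof -
  have "take (Suc l) \<epsilon> \<noteq> []" using l by (cases \<epsilon>) auto
  then have "0 < \<beta> (take l \<epsilon> @ [False])" "0 < \<beta> (take l \<epsilon> @ [True])" "0 < \<beta> (take (Suc l) \<epsilon>)"
    using \<beta> by auto
  then show ?thesis
    unfolding split_moment_eq(1)[OF assms] by simp
qed

subsection \<open>Random measures\<close>

lemma topspace_tight [simp]: "topspace (tight_topology :: 'a::topological_space measure topology) = M1"
proof -
  let ?S = "{{P \<in> M1. (\<integral>x. f x \<partial>P) \<in> W} | (f :: 'a \<Rightarrow> real) W.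
        continuous_on UNIV f \<and> bounded (range f) \<and> open W}"
  have "{P \<in> M1. (\<integral>x. 0 \<partial>P) \<in> (UNIV :: real set)} \<in> ?S"
    by (intro CollectI exI[of _ "\<lambda>_. 0"] exI[of _ UNIV]) auto
  then have "\<Union>?S = M1" by blast
  then show ?thesis unfolding tight_topology_def by simp
qed

lemma sets_borel_of_top: "sets (borel_of_top T) = sigma_sets (topspace T) {U. openin T U}"
  unfolding borel_of_top_def by (rule sets_measure_of) (auto dest: openin_subset)

lemma space_borel_of_top [simp]: "space (borel_of_top T) = topspace T"
  unfolding borel_of_top_def by (rule space_measure_of) (auto dest: openin_subset)

lemma borel_measurable_of_top:
  fixes f :: "'b \<Rightarrow> real"
  assumes "\<And>W. open W \<Longrightarrow> openin T {x \<in> topspace T. f x \<in> W}"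
  shows "f \<in> borel_measurable (borel_of_top T)"
proof (rule borel_measurableI)
  fix W :: "real set" assume "open W"
  then have "{x \<in> topspace T. f x \<in> W} \<in> sets (borel_of_top T)"
    unfolding sets_borel_of_top using assms by blast
  moreover have "f -` W \<inter> space (borel_of_top T) = {x \<in> topspace T. f x \<in> W}" by auto
  ultimately show "f -` W \<inter> space (borel_of_top T) \<in> sets (borel_of_top T)" by simp
qed

lemma integral_indicator_M1:
  assumes "P \<in> M1"
  shows "(\<integral>x. indicator B x \<partial>P) = (measure P B :: real)"
  by (simp add: M1D[OF assms])

lemma openin_weak_measure:
  assumes "(B :: 'a::topological_space set) \<in> sets borel" "open W"
  shows "openin weak_topology {P \<in> M1. measure P B \<in> W}"
proof -
  have "{P \<in> M1. measure P B \<in> W} = {P \<in> M1. (\<integral>x. indicator B x \<partial>P) \<in> W}"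
    using integral_indicator_M1 by (metis (no_types, lifting) Collect_cong)
  moreover have "bounded (range (indicator B :: 'a \<Rightarrow> real))"
    by (auto simp: bounded_iff indicator_def intro!: exI[of _ 1])
  ultimately show ?thesis
    unfolding weak_topology_def using assms
    by (intro topology_generated_by_Basis CollectI exI[of _ "indicator B"] exI[of _ W]) auto
qed

text \<open>The Borel sets of the tight and of the weak topology are handled uniformly by remembering only
  that they contain the evaluation sigma-algebra of \<open>prob_algebra borel\<close>.\<close>

lemma measurable_id_prob_algebra:
  assumes "space M = (M1 :: 'a::topological_space measure set)"
    and "sets (borel :: 'a measure) = sigma_sets UNIV \<G>" "Int_stable \<G>"
    and "\<And>B. B \<in> \<G> \<Longrightarrow> (\<lambda>P. measure P B) \<in> borel_measurable M"
  shows "(\<lambda>P. P) \<in> measurable M (prob_algebra borel)"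
proof (rule measurable_prob_algebra_generated[OF assms(2,3)])
  fix B assume "B \<in> \<G>"
  then have "(\<lambda>P. ennreal (measure P B)) \<in> borel_measurable M"
    using assms(4) by measurable
  then show "(\<lambda>P. emeasure P B) \<in> borel_measurable M"
  proof (rule measurable_cong[THEN iffD1, rotated])
    fix P assume "P \<in> space M"
    then interpret prob_space P using assms(1) M1D(3) by blast
    show "ennreal (measure P B) = emeasure P B" by (simp add: emeasure_eq_measure)
  qed
qed (use assms(1) in \<open>auto simp: M1_def\<close>)

definition random_measure :: "'a::topological_space measure measure \<Rightarrow> bool" where
  "random_measure Q \<longleftrightarrow> prob_space Q \<and> space Q = M1 \<and> (\<lambda>P. P) \<in> measurable Q (prob_algebra borel)"

lemma random_measure_weak:
  fixes Q :: "'a::topological_space measure measure"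
  assumes "borel_prob_on weak_topology Q"
  shows "random_measure Q"
proof -
  have sp: "space Q = M1" and ss: "sets Q = sets (borel_of_top weak_topology)"
    using assms by (auto simp: borel_prob_on_def)
  have "(\<lambda>P. measure P B) \<in> borel_measurable Q" if "B \<in> sets borel" for B :: "'a set"
    unfolding measurable_cong_sets[OF ss refl]
    by (rule borel_measurable_of_top) (use that in \<open>simp add: openin_weak_measure\<close>)
  moreover have "sets (borel :: 'a measure) = sigma_sets UNIV (sets borel)"
    using sets.sigma_sets_eq[of "borel :: 'a measure"] by simp
  ultimately have "(\<lambda>P. P) \<in> measurable Q (prob_algebra (borel :: 'a measure))"
    by (intro measurable_id_prob_algebra[OF sp, of "sets borel"]) (auto simp: Int_stable_def)
  then show ?thesis using assms sp by (simp add: random_measure_def borel_prob_on_def)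
qed

text \<open>Evaluations at sets are in general not continuous for the tight topology. For closed
  \<open>C\<close> the indicator is the pointwise limit of continuous functions of the distance to
  \<open>C\<close>, so P(C) is a limit of measurable functions of P; the closed sets are stable
  under intersection and generate the Borel sets.\<close>

lemma random_measure_tight:
  fixes Q :: "'a::metric_space measure measure"
  assumes "borel_prob_on tight_topology Q"
  shows "random_measure Q"
proof -
  have sp: "space Q = M1" and ss: "sets Q = sets (borel_of_top tight_topology)"
    using assms by (auto simp: borel_prob_on_def)
  have cont: "(\<lambda>P. \<integral>x. f x \<partial>P) \<in> borel_measurable Q"
    if "continuous_on UNIV f" "bounded (range f)" for f :: "'a \<Rightarrow> real"
    unfolding measurable_cong_sets[OF ss refl]
  proof (rule borel_measurable_of_top)
    fix W :: "real set" assume "open W"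
    then have "openin tight_topology {P \<in> M1. (\<integral>x. f x \<partial>P) \<in> W}"
      unfolding tight_topology_def using that by (intro topology_generated_by_Basis) blast
    then show "openin tight_topology {P \<in> topspace tight_topology. (\<integral>x. f x \<partial>P) \<in> W}" by simp
  qed
  have closed: "(\<lambda>P. measure P C) \<in> borel_measurable Q" if C: "closed C" for C :: "'a set"
  \<comment> \<open>\<open>infdist\<close> to the empty set is 0 by convention, so the functions
    \<open>f n\<close> would be constantly 1 and not approximate the indicator.\<close>
  proof (cases "C = {}")
    case False
    define f where "f n x = max 0 (1 - real n * infdist x C)" for n x
    have f_range: "\<bar>f n x\<bar> \<le> 1" for n x
      using infdist_nonneg[of x C] by (auto simp: f_def)
    have f_cont: "continuous_on UNIV (f n)" for n
      unfolding f_def by (intro continuous_intros)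
    have f_lim: "(\<lambda>n. f n x) \<longlonglongrightarrow> indicator C x" for x
    proof (cases "x \<in> C")
      case True
      then show ?thesis by (simp add: f_def)
    next
      case out: False
      then have "0 < infdist x C" using infdist_pos_not_in_closed[OF C False] by simp
      then obtain N :: nat where N: "1 < real N * infdist x C"
        using reals_Archimedean3 by blast
      have "f n x = 0" if "N \<le> n" for n
      proof -
        have "real N * infdist x C \<le> real n * infdist x C"
          using that infdist_nonneg[of x C] by (intro mult_right_mono) auto
        then show ?thesis using N by (simp add: f_def)
      qed
      then have "\<forall>\<^sub>F n in sequentially. f n x = 0"
        by (auto simp: eventually_sequentially)
      then show ?thesis using out by (simp add: tendsto_eventually)
    qed
    show ?thesis
    proof (rule borel_measurable_LIMSEQ_real)
      show "(\<lambda>P. \<integral>x. f n x \<partial>P) \<in> borel_measurable Q" for n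
        using f_range by (intro cont f_cont) (auto simp: bounded_iff)
      fix P assume "P \<in> space Q"
      then have P: "P \<in> M1" using sp by simp
      interpret prob_space P by (rule M1D[OF P])
      have [measurable_cong, simp]: "sets P = sets borel" by (rule M1D[OF P])
      have [measurable]: "f n \<in> borel_measurable borel" for n
        by (rule borel_measurable_continuous_onI[OF f_cont])
      have [measurable]: "C \<in> sets borel" using C by (rule borel_closed)
      have "(\<lambda>n. \<integral>x. f n x \<partial>P) \<longlonglongrightarrow> (\<integral>x. indicator C x \<partial>P)"
        by (rule integral_dominated_convergence[where w="\<lambda>_. 1"]) (use f_lim f_range in auto)
      then show "(\<lambda>n. \<integral>x. f n x \<partial>P) \<longlonglongrightarrow> measure P C"
        by (simp only: integral_indicator_M1[OF P])
    qed
  qed simp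
  have "sets (borel :: 'a measure) = sigma_sets UNIV {C. closed C}"
    by (subst borel_eq_closed) simp
  then have "(\<lambda>P. P) \<in> measurable Q (prob_algebra (borel :: 'a measure))"
    by (rule measurable_id_prob_algebra[OF sp]) (auto simp: Int_stable_def closed)
  then show ?thesis using assms sp by (simp add: random_measure_def borel_prob_on_def)
qed

lemma random_measureD:
  assumes "random_measure Q"
  shows "prob_space Q" "space Q = M1" "B \<in> sets borel \<Longrightarrow> (\<lambda>P. measure P B) \<in> borel_measurable Q"
proof -
  show "prob_space Q" "space Q = M1" using assms by (auto simp: random_measure_def)
  assume B: "B \<in> sets borel"
  have "(\<lambda>P. P) \<in> measurable Q (prob_algebra borel)" using assms by (simp add: random_measure_def)
  from measurable_compose[OF this measurable_measure_prob_algebra[OF B]]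
  show "(\<lambda>P. measure P B) \<in> borel_measurable Q" .
qed

text \<open>The mean measure is the monadic join of \<open>Q\<close>, obtained as a
  \<open>bind\<close> with the identity. Its countable additivity is inherited from there, which
  shows that \<open>measure_of\<close> takes the intended values.\<close>

lemma mean_measure:
  fixes Q :: "'a::topological_space measure measure"
  assumes "random_measure Q"
  shows mean_measure_M1: "mean_measure Q \<in> M1"
    and measure_mean_measure: "B \<in> sets borel \<Longrightarrow> measure (mean_measure Q) B = (\<integral>P. measure P B \<partial>Q)"
proof -
  interpret prob_space Q by (rule random_measureD[OF assms])
  have id: "(\<lambda>P. P) \<in> measurable Q (subprob_algebra (borel :: 'a measure))"
    using assms unfolding random_measure_def by (auto intro: measurable_prob_algebraD)
  define N where "N = Q \<bind> (\<lambda>P. P)"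
  have [simp]: "sets N = sets borel"
    unfolding N_def by (rule sets_bind) (use not_empty random_measureD(2)[OF assms] M1D(1) in auto)
  have [simp]: "space N = UNIV" using sets_eq_imp_space_eq[of N borel] by simp
  have em: "emeasure N B = (\<integral>\<^sup>+P. emeasure P B \<partial>Q)" if "B \<in> sets borel" for B
    unfolding N_def by (rule emeasure_bind[OF not_empty id that])
  have "mean_measure Q = measure_of UNIV (sets borel) (emeasure N)"
    unfolding mean_measure_def using sets.sigma_sets_eq[of "borel :: 'a measure"]
    by (intro measure_of_eq) (auto simp: em)
  also have "\<dots> = N" using measure_of_of_measure[of N] by simp
  finally have N: "mean_measure Q = N" .
  have "prob_space N"
    unfolding N_def
    by (rule prob_space_bind[OF _ id]) (use random_measureD(2)[OF assms] M1D(3) in auto)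
  then show "mean_measure Q \<in> M1" by (simp add: N M1_def)
  assume B: "B \<in> sets borel"
  have meas: "(\<lambda>P. measure P B) \<in> borel_measurable Q" by (rule random_measureD(3)[OF assms B])
  have int: "integrable Q (\<lambda>P. measure P B)"
  proof (rule integrable_const_bound[of _ 1])
    show "AE P in Q. norm (measure P B) \<le> 1"
      using random_measureD(2)[OF assms] M1D(3) by (auto intro!: AE_I2 prob_space.prob_le_1)
  qed (rule meas)
  have "emeasure N B = (\<integral>\<^sup>+P. ennreal (measure P B) \<partial>Q)"
    unfolding em[OF B]
  proof (rule nn_integral_cong)
    fix P assume "P \<in> space Q"
    then interpret P: prob_space P using random_measureD(2)[OF assms] M1D(3) by auto
    show "emeasure P B = ennreal (measure P B)" by (rule P.emeasure_eq_measure)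
  qed
  also have "\<dots> = ennreal (\<integral>P. measure P B \<partial>Q)"
    by (rule nn_integral_eq_integral[OF int]) simp
  finally show "measure (mean_measure Q) B = (\<integral>P. measure P B \<partial>Q)"
    unfolding N by (intro measure_eq_emeasure_eq_ennreal Bochner_Integration.integral_nonneg) auto
qed

text \<open>Joint convexity of (a, g) \<mapsto> a^2 / g for g > 0, with an exact square as defect.
  It says that splitting a cell cannot lower the energy.\<close>

lemma square_add_div_le:
  assumes "0 < g" "0 < (h::real)"
  shows "(a + b)\<^sup>2 / (g + h) \<le> a\<^sup>2 / g + b\<^sup>2 / h"
proof -
  have "a\<^sup>2 / g + b\<^sup>2 / h - (a + b)\<^sup>2 / (g + h) = (a * h - b * g)\<^sup>2 / (g * h * (g + h))"
    using assms by (simp add: field_simps power2_eq_square)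
  moreover have "0 \<le> (a * h - b * g)\<^sup>2 / (g * h * (g + h))" using assms by simp
  ultimately show ?thesis by linarith
qed

section \<open>Cylinder masses of a random measure and their energy\<close>

context dyadic_tree
begin

lemma coords_measurable:
  assumes "random_measure Q"
  shows "coords \<in> borel_measurable Q"
  by (rule measurable_coordinatewise_then_product) (simp add: coords_def random_measureD(3)[OF assms])

lemma proj_measurable:
  assumes "random_measure Q"
  shows "(\<lambda>P. \<lambda>\<epsilon>\<in>strings m. measure P (A \<epsilon>)) \<in> measurable Q (PiM (strings m) (\<lambda>_. borel))"
  by (intro measurable_restrict random_measureD(3)[OF assms] A_borel)

lemma integral_coords_power:
  assumes Q: "random_measure Q" and proj: "projects_to Q A \<beta> m"
    and \<beta>: "\<forall>\<epsilon>. \<epsilon> \<noteq> [] \<longrightarrow> \<beta> \<epsilon> > 0" and \<epsilon>: "\<epsilon> \<in> strings m"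
  shows "(\<integral>P. coords P \<epsilon> ^ p \<partial>Q) = (\<Prod>l<m. split_moment \<beta> p \<epsilon> l)"
proof -
  have "(\<integral>x. (x \<epsilon>) ^ p \<partial>distr Q (PiM (strings m) (\<lambda>_. borel)) (\<lambda>P. \<lambda>\<epsilon>\<in>strings m. measure P (A \<epsilon>)))
      = (\<integral>P. coords P \<epsilon> ^ p \<partial>Q)"
    by (subst integral_distr[OF proj_measurable[OF Q]])
       (use \<epsilon> in \<open>simp_all add: coords_def borel_measurable_power measurable_component_singleton\<close>)
  then show ?thesis
    using integral_polya_hist[OF \<beta> \<epsilon>, of p] proj by (simp add: projects_to_def)
qed

lemma mean_measure_A:
  assumes Q: "random_measure Q" and proj: "\<forall>m\<ge>1. projects_to Q A \<beta> m"
    and \<beta>: "\<forall>\<epsilon>. \<epsilon> \<noteq> [] \<longrightarrow> \<beta> \<epsilon> > 0"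
  shows "measure (mean_measure Q) (A \<epsilon>) = (\<Prod>l<length \<epsilon>. split_moment \<beta> 1 \<epsilon> l)"
proof (cases "\<epsilon> = []")
  \<comment> \<open>The projection hypothesis starts at level 1, so the root is settled by total
    mass 1.\<close>
  case True
  note M1 = mean_measure_M1[OF Q]
  show ?thesis
    using True prob_space.prob_space[OF M1D(3)[OF M1]] by (simp add: root M1D(2)[OF M1])
next
  case False
  then have "1 \<le> length \<epsilon>" by (cases \<epsilon>) auto
  then have "(\<integral>P. coords P \<epsilon> ^ 1 \<partial>Q) = (\<Prod>l<length \<epsilon>. split_moment \<beta> 1 \<epsilon> l)"
    using proj by (intro integral_coords_power[OF Q _ \<beta>]) (auto simp: strings_def)
  then show ?thesis
    unfolding measure_mean_measure[OF Q A_borel] by (simp add: coords_def)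
qed

text \<open>The mean mass of a cell is a finite product of quotients of positive parameters, hence
  positive.\<close>

lemma reference_tree_mean:
  assumes Q: "random_measure Q" and proj: "\<forall>m\<ge>1. projects_to Q A \<beta> m"
    and \<beta>: "\<forall>\<epsilon>. \<epsilon> \<noteq> [] \<longrightarrow> \<beta> \<epsilon> > 0"
  shows "reference_tree A (mean_measure Q)"
proof
  show "mean_measure Q \<in> M1" by (rule mean_measure_M1[OF Q])
  show "0 < measure (mean_measure Q) (A \<epsilon>)" for \<epsilon>
    unfolding mean_measure_A[OF assms] by (intro prod_pos) (use split_moment_1_pos[OF \<beta>] in \<open>simp del: One_nat_def\<close>)
qed

end

context reference_tree
begin

lemma energy_mono:
  assumes P: "P \<in> M1" and "m \<le> n"
  shows "energy (coords P) m \<le> energy (coords P) n"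
  using assms(2)
proof (induction n rule: dec_induct)
  case (step n)
  have "energy (coords P) n \<le> energy (coords P) (Suc n)"
    unfolding energy_def sum_strings_Suc
  proof (rule sum_mono)
    fix \<epsilon>
    have "(coords P \<epsilon>)\<^sup>2 / measure G (A \<epsilon>) = (coords P (\<epsilon> @ [False]) + coords P (\<epsilon> @ [True]))\<^sup>2 /
        (measure G (A (\<epsilon> @ [False])) + measure G (A (\<epsilon> @ [True])))"
      using coords_additive[OF P, of \<epsilon>] coords_additive[OF G_M1, of \<epsilon>] by (simp add: coords_def)
    also have "\<dots> \<le> (coords P (\<epsilon> @ [False]))\<^sup>2 / measure G (A (\<epsilon> @ [False])) + (coords P (\<epsilon> @ [True]))\<^sup>2 / measure G (A (\<epsilon> @ [True]))"
      by (intro square_add_div_le G_pos)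
    finally show "(coords P \<epsilon>)\<^sup>2 / measure G (A \<epsilon>) \<le> \<dots>" .
  qed
  then show ?case using step by simp
qed simp

lemma bounded_energy_mono: "R \<le> S \<Longrightarrow> bounded_energy R \<subseteq> bounded_energy S"
  unfolding bounded_energy_def by (auto intro: order_trans)

definition finite_energy :: "(bool list \<Rightarrow> real) set" where
  "finite_energy = (\<Union>n::nat. bounded_energy (real n))"

lemma finite_energy_borel: "finite_energy \<in> sets borel"
  unfolding finite_energy_def by (intro sets.countable_UN) (auto intro: borel_closed closed_bounded_energy)

text \<open>Monotone convergence: the supremum of the energies over all levels has mean at most
  \<open>C\<close> and is therefore finite almost surely. Levels are written \<open>Suc m\<close>
  because the bound starts at level 1; level 0 then follows by monotonicity.\<close>

lemma AE_finite_energy: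
  assumes Q: "random_measure Q" and C: "\<And>m. 1 \<le> m \<Longrightarrow> (\<integral>P. energy (coords P) m \<partial>Q) \<le> C"
  shows "AE P in Q. coords P \<in> finite_energy"
proof -
  interpret Q: prob_space Q by (rule random_measureD[OF Q])
  have sp: "space Q = M1" by (rule random_measureD[OF Q])
  have meas[measurable]: "(\<lambda>P. energy (coords P) m) \<in> borel_measurable Q" for m
    unfolding energy_def coords_def
    by (intro borel_measurable_sum borel_measurable_divide borel_measurable_power random_measureD(3)[OF Q]) auto
  have nonneg: "0 \<le> energy (coords P) m" for P m
    unfolding energy_def by (intro sum_nonneg) auto
  have int: "integrable Q (\<lambda>P. energy (coords P) m)" for m
  proof (rule Q.integrable_const_bound[OF _ meas])
    \<comment> \<open>This bound depends on \<open>m\<close> and yields integrability at each level,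
      so that the Bochner bound \<open>C\<close> becomes a bound on the nonnegative
      integral.\<close>
    show "AE P in Q. norm (energy (coords P) m) \<le> (\<Sum>\<epsilon>\<in>strings m. 1 / measure G (A \<epsilon>))"
    proof (rule AE_I2)
      fix P assume "P \<in> space Q"
      then interpret P: prob_space P using sp M1D(3) by auto
      have "energy (coords P) m \<le> (\<Sum>\<epsilon>\<in>strings m. 1 / measure G (A \<epsilon>))"
        unfolding energy_def coords_def
        by (intro sum_mono divide_right_mono) (auto simp: power_le_one)
      then show "norm (energy (coords P) m) \<le> (\<Sum>\<epsilon>\<in>strings m. 1 / measure G (A \<epsilon>))"
        using nonneg[of P m] by simp
    qed
  qed
  have bound: "(\<integral>\<^sup>+P. ennreal (energy (coords P) (Suc m)) \<partial>Q) \<le> ennreal C" for m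
    using C[of "Suc m"] nonneg by (subst nn_integral_eq_integral[OF int]) (auto intro: ennreal_leI)
  let ?S = "\<lambda>P. SUP m. ennreal (energy (coords P) (Suc m))"
  have "(\<integral>\<^sup>+P. ?S P \<partial>Q) = (SUP m. \<integral>\<^sup>+P. ennreal (energy (coords P) (Suc m)) \<partial>Q)"
    by (rule nn_integral_monotone_convergence_SUP_AE)
       (auto intro!: AE_I2 ennreal_leI energy_mono simp: sp)
  also have "\<dots> \<le> ennreal C" by (rule SUP_least) (rule bound)
  finally have "(\<integral>\<^sup>+P. ?S P \<partial>Q) \<noteq> \<infinity>" by (auto simp: top_unique)
  then have "AE P in Q. ?S P \<noteq> \<infinity>" by (intro nn_integral_PInf_AE) auto
  then show ?thesis
  proof (rule AE_mp, intro AE_I2 impI)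
    fix P assume "P \<in> space Q" and fin: "?S P \<noteq> \<infinity>"
    then have P: "P \<in> M1" using sp by simp
    obtain n :: nat where n: "enn2real (?S P) \<le> real n" using real_arch_simple by blast
    have "energy (coords P) m \<le> real n" for m
    proof -
      have "ennreal (energy (coords P) (Suc m)) \<le> ?S P" by (rule SUP_upper) simp
      moreover have "?S P < top" using fin by (simp only: less_top infinity_ennreal_def)
      ultimately have "enn2real (ennreal (energy (coords P) (Suc m))) \<le> enn2real (?S P)"
        by (rule enn2real_mono)
      then have "energy (coords P) (Suc m) \<le> enn2real (?S P)"
        by (simp only: enn2real_ennreal[OF nonneg])
      then show ?thesis using n energy_mono[OF P, of m "Suc m"] by simp
    qed
    then show "coords P \<in> finite_energy"
      unfolding finite_energy_def using coords_bounded_energy[OF P] by auto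
  qed
qed

lemma absolutely_continuous_finite_energy:
  assumes P: "P \<in> M1" and en: "coords P \<in> finite_energy"
  shows "absolutely_continuous G P"
  unfolding absolutely_continuous_def
proof
  interpret P: prob_space P by (rule M1D[OF P])
  fix N assume N: "N \<in> null_sets G"
  then have N_borel: "N \<in> sets borel" by (auto simp: null_sets_def)
  obtain n :: nat where "coords P \<in> bounded_energy (real n)" using en by (auto simp: finite_energy_def)
  from measure_square_le[OF P this N_borel] have "measure P N = 0"
    using N by (simp add: null_sets_def measure_def)
  then show "N \<in> null_sets P"
    using N_borel by (simp add: null_sets_def P.emeasure_eq_measure M1D[OF P])
qed

end

subsection \<open>Radon laws\<close>

context dyadic_tree
begin

lemma coords_eq_sum:
  assumes P: "P \<in> M1" and le: "length \<epsilon> \<le> m"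
  shows "coords P \<epsilon> = (\<Sum>\<delta>\<in>{\<delta>\<in>strings m. A \<delta> \<subseteq> A \<epsilon>}. coords P \<delta>)"
  unfolding coords_def by (rule measure_cylinder[OF P saturated_mono[OF saturated_A le]])

text \<open>An event about finitely many strings is an event about the histogram of one deep enough
  level, since the mass of a shorter string is a sum of masses of that level. The law of that
  histogram is prescribed, and such events determine a law on the product.\<close>

lemma distr_coords_eq:
  assumes Q1: "random_measure Q1" "\<forall>m\<ge>1. projects_to Q1 A \<beta> m"
    and Q2: "random_measure Q2" "\<forall>m\<ge>1. projects_to Q2 A \<beta> m"
  shows "distr Q1 borel coords = distr Q2 borel coords"
proof (rule measure_eqI_PiM_infinite[where I=UNIV and M="\<lambda>_. borel"])
  interpret Q1: prob_space Q1 by (rule random_measureD[OF Q1(1)])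
  show "sets (distr Q1 borel coords) = PiM UNIV (\<lambda>_. borel)"
    "sets (distr Q2 borel coords) = PiM UNIV (\<lambda>_. borel)"
    by (simp_all add: sets_PiM_equal_borel)
  show "finite_measure (distr Q1 borel coords)"
    by (intro Q1.finite_measure_distr coords_measurable Q1(1))
  fix F :: "bool list \<Rightarrow> real set" and J :: "bool list set"
  assume J: "finite J" and F: "\<And>\<epsilon>. \<epsilon> \<in> J \<Longrightarrow> F \<epsilon> \<in> sets borel"
  let ?E = "prod_emb UNIV (\<lambda>_. borel) J (Pi\<^sub>E J F) :: (bool list \<Rightarrow> real) set"
  \<comment> \<open>\<open>Suc\<close> secures \<open>1 \<le> m\<close>, as the histograms are
    prescribed only from level 1 on.\<close>
  obtain m where m: "1 \<le> m" "\<And>\<epsilon>. \<epsilon> \<in> J \<Longrightarrow> length \<epsilon> \<le> m"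
    using J by (intro that[of "Suc (Max (length ` J))"]) (auto intro: le_SucI)
  define N where "N = (PiM (strings m) (\<lambda>_. borel) :: (bool list \<Rightarrow> real) measure)"
  define Z where "Z = {x \<in> space N. \<forall>\<epsilon>\<in>J. (\<Sum>\<delta>\<in>{\<delta>\<in>strings m. A \<delta> \<subseteq> A \<epsilon>}. x \<delta>) \<in> F \<epsilon>}"
  have "{x \<in> space N. (\<Sum>\<delta>\<in>{\<delta>\<in>strings m. A \<delta> \<subseteq> A \<epsilon>}. x \<delta>) \<in> F \<epsilon>} \<in> sets N" if "\<epsilon> \<in> J" for \<epsilon>
  proof -
    have "(\<lambda>x. \<Sum>\<delta>\<in>{\<delta>\<in>strings m. A \<delta> \<subseteq> A \<epsilon>}. x \<delta>) \<in> borel_measurable N"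
      unfolding N_def by (intro borel_measurable_sum measurable_component_singleton) auto
    from measurable_sets[OF this F[OF that]] show ?thesis
      by (simp add: vimage_def Int_def conj_commute)
  qed
  then have Z: "Z \<in> sets N"
    unfolding Z_def using J by (intro sets.sets_Collect_finite_All) auto
  have E: "?E = {x. \<forall>\<epsilon>\<in>J. x \<epsilon> \<in> F \<epsilon>}"
    by (auto simp: prod_emb_def PiE_iff restrict_def extensional_def)
  have E_borel: "?E \<in> sets borel"
    using sets_PiM_I[of J UNIV F "\<lambda>_. borel"] J F unfolding sets_PiM_equal_borel by simp
  have "emeasure (distr Q borel coords) ?E = emeasure (polya_hist \<beta> m) Z"
    if Q: "random_measure Q" and proj: "\<forall>m\<ge>1. projects_to Q A \<beta> m" for Q
  proof -
    let ?p = "\<lambda>P. \<lambda>\<epsilon>\<in>strings m. measure P (A \<epsilon>)"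
    have sp: "space Q = M1" by (rule random_measureD[OF Q])
    have "coords -` ?E \<inter> space Q = ?p -` Z \<inter> space Q"
    proof (intro set_eqI)
      fix P
      show "P \<in> coords -` ?E \<inter> space Q \<longleftrightarrow> P \<in> ?p -` Z \<inter> space Q"
      proof (cases "P \<in> M1")
        case True
        have "?p P \<in> space N" by (simp add: N_def space_PiM)
        moreover have "(\<Sum>\<delta>\<in>{\<delta>\<in>strings m. A \<delta> \<subseteq> A \<epsilon>}. ?p P \<delta>) = coords P \<epsilon>" if "\<epsilon> \<in> J" for \<epsilon>
          unfolding coords_eq_sum[OF True m(2)[OF that]]
          by (intro sum.cong) (auto simp: coords_def)
        ultimately show ?thesis unfolding E Z_def using True sp by auto
      qed (simp add: sp)
    qed
    then have "emeasure (distr Q borel coords) ?E = emeasure (distr Q N ?p) Z"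
      using emeasure_distr[OF coords_measurable[OF Q] E_borel]
        emeasure_distr[OF proj_measurable[OF Q, of m] Z[unfolded N_def]] by (simp add: N_def)
    then show ?thesis using proj m(1) by (simp add: projects_to_def N_def)
  qed
  then show "emeasure (distr Q1 borel coords) ?E = emeasure (distr Q2 borel coords) ?E"
    using Q1 Q2 by simp
qed

lemma continuous_map_coords: "continuous_map weak_topology euclidean coords"
proof -
  have "continuous_map weak_topology euclidean (\<lambda>P. coords P \<epsilon>)" for \<epsilon>
    unfolding continuous_map coords_def
    using openin_weak_measure[OF A_borel] by auto
  then have "continuous_map weak_topology (product_topology (\<lambda>_. euclidean) UNIV) coords"
    by (simp add: continuous_map_componentwise_UNIV)
  then show ?thesis by (simp add: euclidean_product_topology)
qed

text \<open>By continuity the image of \<open>K\<close> under \<open>coords\<close> is compact,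
  hence Borel; by injectivity on \<open>M1\<close> its preimage is \<open>K\<close> again. This also
  makes \<open>K\<close> measurable for \<open>Q\<close>.\<close>

lemma measure_compact_eq:
  assumes Q: "random_measure Q" and K: "compactin weak_topology K"
  shows "measure Q K = measure (distr Q borel coords) (coords ` K)"
proof -
  have sp: "space Q = M1" by (rule random_measureD[OF Q])
  have KM: "K \<subseteq> M1" using compactin_subset_topspace[OF K] by simp
  have "compact (coords ` K)"
    using image_compactin[OF K continuous_map_coords] by simp
  then have "coords ` K \<in> sets borel"
    by (intro borel_closed compact_imp_closed)
  moreover have "coords -` (coords ` K) \<inter> space Q = K"
  proof
    show "coords -` coords ` K \<inter> space Q \<subseteq> K"
    proof
      fix P assume "P \<in> coords -` coords ` K \<inter> space Q"
      then obtain P' where "P' \<in> K" "coords P = coords P'" "P \<in> M1" using sp by auto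
      moreover from this have "P = P'"
        using KM by (intro M1_eqI) (auto simp: coords_def fun_eq_iff)
      ultimately show "P \<in> K" by simp
    qed
  qed (use KM sp in auto)
  ultimately show ?thesis
    by (subst measure_distr[OF coords_measurable[OF Q]]) auto
qed

lemma radon_unique:
  assumes Q1: "radon_prob_on weak_topology Q1" "\<forall>m\<ge>1. projects_to Q1 A \<beta> m"
    and Q2: "radon_prob_on weak_topology Q2" "\<forall>m\<ge>1. projects_to Q2 A \<beta> m"
  shows "Q1 = Q2"
proof (rule measure_eqI)
  have rm: "random_measure Q1" "random_measure Q2"
    using Q1 Q2 by (auto simp: radon_prob_on_def intro: random_measure_weak)
  interpret Q1: prob_space Q1 by (rule random_measureD[OF rm(1)])
  interpret Q2: prob_space Q2 by (rule random_measureD[OF rm(2)])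
  show sets: "sets Q1 = sets Q2"
    using Q1(1) Q2(1) by (simp add: radon_prob_on_def borel_prob_on_def)
  fix B assume B: "B \<in> sets Q1"
  have "measure Q1 B = (SUP K\<in>{K. K \<subseteq> B \<and> K \<in> sets Q1 \<and> compactin weak_topology K}. measure Q1 K)"
    using Q1(1) B by (simp add: radon_prob_on_def)
  also have "\<dots> = (SUP K\<in>{K. K \<subseteq> B \<and> K \<in> sets Q2 \<and> compactin weak_topology K}. measure Q2 K)"
    unfolding sets
    by (intro SUP_cong refl)
       (simp add: measure_compact_eq rm distr_coords_eq[OF rm(1) Q1(2) rm(2) Q2(2)])
  also have "\<dots> = measure Q2 B"
    using Q2(1) B sets by (simp add: radon_prob_on_def)
  finally show "emeasure Q1 B = emeasure Q2 B"
    by (simp add: Q1.emeasure_eq_measure Q2.emeasure_eq_measure)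
qed

lemma integral_energy:
  assumes Q: "random_measure Q" and proj: "\<forall>m\<ge>1. projects_to Q A \<beta> m"
    and \<beta>: "\<forall>\<epsilon>. \<epsilon> \<noteq> [] \<longrightarrow> \<beta> \<epsilon> > 0" and m: "1 \<le> m"
  shows "(\<integral>P. reference_tree.energy A (mean_measure Q) (coords P) m \<partial>Q) = polya_sum \<beta> m"
proof -
  interpret Q: prob_space Q by (rule random_measureD[OF Q])
  interpret reference_tree A "mean_measure Q" by (rule reference_tree_mean[OF Q proj \<beta>])
  have int: "integrable Q (\<lambda>P. (coords P \<epsilon>)\<^sup>2)" for \<epsilon>
  proof (rule Q.integrable_const_bound[of _ 1])
    show "AE P in Q. norm ((coords P \<epsilon>)\<^sup>2) \<le> 1"
      using random_measureD(2)[OF Q] M1D(3)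
      by (auto simp: coords_def intro!: AE_I2 power_le_one prob_space.prob_le_1)
    show "(\<lambda>P. (coords P \<epsilon>)\<^sup>2) \<in> borel_measurable Q"
      unfolding coords_def by (intro borel_measurable_power random_measureD(3)[OF Q] A_borel)
  qed
  have "(\<integral>P. energy (coords P) m \<partial>Q) =
      (\<Sum>\<epsilon>\<in>strings m. (\<integral>P. (coords P \<epsilon>)\<^sup>2 \<partial>Q) / measure (mean_measure Q) (A \<epsilon>))"
    unfolding energy_def using int by simp
  also have "\<dots> = polya_sum \<beta> m"
    unfolding polya_sum_eq[OF \<beta>]
  proof (intro sum.cong refl)
    fix \<epsilon> assume \<epsilon>: "\<epsilon> \<in> strings m"
    then have "length \<epsilon> = m" by (simp add: strings_def)
    then show "(\<integral>P. (coords P \<epsilon>)\<^sup>2 \<partial>Q) / measure (mean_measure Q) (A \<epsilon>) =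
        (\<Prod>l<m. split_moment \<beta> 2 \<epsilon> l) / (\<Prod>l<m. split_moment \<beta> 1 \<epsilon> l)"
      using integral_coords_power[OF Q _ \<beta> \<epsilon>, of 2] proj m
      by (simp add: mean_measure_A[OF Q proj \<beta>])
  qed
  finally show ?thesis .
qed

end

section \<open>Transport of the law of the masses to a Radon law\<close>

context reference_tree
begin

text \<open>The push-forward needs a map on the whole product with values in \<open>M1\<close>.
  \<open>G\<close> is a default value; it is taken on a null set of the laws to which the map is
  applied.\<close>

definition realize_total :: "(bool list \<Rightarrow> real) \<Rightarrow> 'a measure" where
  "realize_total \<theta> = (if \<theta> \<in> finite_energy then realize \<theta> else G)"

lemma realize_total_M1: "realize_total \<theta> \<in> M1"
  using realize_M1 G_M1 by (auto simp: realize_total_def finite_energy_def)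

lemma coords_realize_total: "\<theta> \<in> finite_energy \<Longrightarrow> coords (realize_total \<theta>) = \<theta>"
  using coords_realize by (auto simp: realize_total_def finite_energy_def)

text \<open>The weak topology may have no countable base, so an arbitrary weakly open set is treated
  directly: its preimage in each closed set \<open>bounded_energy (real n)\<close> is relatively
  open by continuity of \<open>realize\<close>, hence Borel, and countably many such pieces cover
  \<open>finite_energy\<close>.\<close>

lemma measurable_realize_total:
  "realize_total \<in> measurable borel (borel_of_top weak_topology)"
  unfolding borel_of_top_def
proof (rule measurable_measure_of)
  show "{U. openin weak_topology U} \<subseteq> Pow (topspace weak_topology)"
    using openin_subset by blast
  show "realize_total \<in> space borel \<rightarrow> topspace weak_topology" by (simp add: realize_total_M1)
  fix U :: "'a measure set" assume "U \<in> {U. openin weak_topology U}"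
  then have U: "openin weak_topology U" by simp
  have "realize -` U \<inter> bounded_energy (real n) \<in> sets borel" for n
  proof -
    have "openin (top_of_set (bounded_energy (real n))) {\<theta> \<in> bounded_energy (real n). realize \<theta> \<in> U}"
      using openin_continuous_map_preimage[OF continuous_map_realize U] by simp
    then obtain V where "open V" "{\<theta> \<in> bounded_energy (real n). realize \<theta> \<in> U} = bounded_energy (real n) \<inter> V"
      by (auto simp: openin_open)
    moreover have "realize -` U \<inter> bounded_energy (real n) = {\<theta> \<in> bounded_energy (real n). realize \<theta> \<in> U}"
      by auto
    ultimately show ?thesis
      using closed_bounded_energy by (simp add: borel_open borel_closed sets.Int)
  qed
  then have "(\<Union>n. realize -` U \<inter> bounded_energy (real n)) \<in> sets borel"
    by (intro sets.countable_UN) auto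
  moreover have "(if G \<in> U then - finite_energy else {}) \<in> sets borel"
    using finite_energy_borel sets.compl_sets[of finite_energy borel] by (simp add: Compl_eq_Diff_UNIV)
  moreover have "realize_total -` U \<inter> space borel =
      (\<Union>n. realize -` U \<inter> bounded_energy (real n)) \<union> (if G \<in> U then - finite_energy else {})"
    by (auto simp: realize_total_def finite_energy_def split: if_splits)
  ultimately show "realize_total -` U \<inter> space borel \<in> sets borel" by simp
qed

lemma compactin_realize_total:
  assumes K: "compact K" "K \<subseteq> bounded_energy (real n)"
  shows "compactin weak_topology (realize_total ` K)"
proof -
  have "compactin (top_of_set (bounded_energy (real n))) K"
    using K by (simp add: compactin_subtopology)
  then have "compactin weak_topology (realize ` K)"
    by (rule image_compactin[OF _ continuous_map_realize])
  moreover have "realize_total ` K = realize ` K"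
    using K(2) by (intro image_cong) (auto simp: realize_total_def finite_energy_def)
  ultimately show ?thesis by simp
qed

text \<open>\<open>realize\<close> is known to be continuous only at bounded energy. The preimage of
  \<open>B\<close> is therefore first cut down to an energy level, at the cost of
  \<open>e / 2\<close>, and only then replaced by a compact subset, at the cost of another
  \<open>e / 2\<close>; the image of that subset is weakly compact.\<close>

lemma radon_realize_total:
  assumes prob: "prob_space L" and [simp]: "sets L = sets borel"
    and full: "AE \<theta> in L. \<theta> \<in> finite_energy"
  shows "radon_prob_on weak_topology (distr L (borel_of_top weak_topology) realize_total)"
    (is "radon_prob_on _ ?Q")
proof -
  interpret L: prob_space L by fact
  have T: "realize_total \<in> measurable L (borel_of_top weak_topology)"
    using measurable_realize_total by (simp cong: measurable_cong_sets)
  have [simp]: "space L = UNIV" using sets_eq_imp_space_eq[of L borel] by simp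
  interpret Q: prob_space ?Q by (rule L.prob_space_distr[OF T])
  have bp: "borel_prob_on weak_topology ?Q"
    unfolding borel_prob_on_def using Q.prob_space_axioms by simp
  have coords_meas: "coords \<in> borel_measurable ?Q"
    by (rule coords_measurable[OF random_measure_weak[OF bp]])
  have approx: "\<exists>K. K \<subseteq> B \<and> K \<in> sets ?Q \<and> compactin weak_topology K \<and> measure ?Q B - e \<le> measure ?Q K"
    if B: "B \<in> sets ?Q" and e: "0 < e" for B e
  proof -
    let ?B = "realize_total -` B"
    have B_borel: "?B \<in> sets borel" using measurable_sets[OF T, of B] B by simp
    define C where "C n = ?B \<inter> bounded_energy (real n)" for n
    have C_borel: "C n \<in> sets borel" for n
      unfolding C_def using B_borel borel_closed[OF closed_bounded_energy] by (rule sets.Int)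
    have "(\<lambda>n. measure L (C n)) \<longlonglongrightarrow> measure L (\<Union>n. C n)"
    proof (rule L.finite_Lim_measure_incseq)
      show "incseq C"
        unfolding C_def by (intro incseq_SucI Int_mono subset_refl bounded_energy_mono) simp
    qed (use C_borel in auto)
    moreover have "measure L (\<Union>n. C n) = measure L ?B"
    proof (rule measure_eq_AE)
      show "AE \<theta> in L. \<theta> \<in> (\<Union>n. C n) \<longleftrightarrow> \<theta> \<in> ?B"
        using full by eventually_elim (auto simp: C_def finite_energy_def)
    qed (use C_borel B_borel in auto)
    moreover have "measure L ?B = measure ?Q B"
      using measure_distr[OF T, of B] B by simp
    ultimately have "\<forall>\<^sub>F n in sequentially. measure ?Q B - e / 2 < measure L (C n)"
      using e by (intro order_tendstoD(1)) auto
    then obtain n where n: "measure ?Q B - e / 2 < measure L (C n)"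
      by (auto simp: eventually_sequentially)
    obtain K where K: "K \<subseteq> C n" "compact K" "measure L (C n) - e / 2 \<le> measure L K"
    \<comment> \<open>\<open>ennreal\<close> sends negative reals to 0, so the strict inequality
      used to pick \<open>K\<close> needs positive mass. At mass 0 the empty set is good
      enough.\<close>
    proof (cases "0 < measure L (C n)")
      case True
      have sup: "emeasure L (C n) = (SUP K\<in>{K. K \<subseteq> C n \<and> compact K}. emeasure L K)"
        by (rule inner_regular) (simp_all add: C_borel L.emeasure_finite)
      have "ennreal (measure L (C n) - e / 2) < emeasure L (C n)"
        unfolding L.emeasure_eq_measure using True e by (intro ennreal_lessI) auto
      then obtain K where K: "K \<subseteq> C n" "compact K" "ennreal (measure L (C n) - e / 2) < emeasure L K"
        unfolding sup less_SUP_iff by auto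
      then have "measure L (C n) - e / 2 \<le> measure L K"
        unfolding L.emeasure_eq_measure by (metis ennreal_leI linorder_not_le order_less_imp_le)
      with K show thesis by (intro that)
    next
      case False
      show thesis by (rule that[of "{}"]) (use False e in auto)
    qed
    let ?K = "realize_total ` K"
    \<comment> \<open>Measurability of the compact image is read off from this: it is the preimage
      of a compact set under the measurable map \<open>coords\<close>.\<close>
    have "?K = coords -` K \<inter> space ?Q"
    proof (intro equalityI subsetI)
      fix P assume "P \<in> ?K"
      then obtain \<theta> where \<theta>: "\<theta> \<in> K" "P = realize_total \<theta>" by auto
      then have "\<theta> \<in> bounded_energy (real n)" using K(1) by (auto simp: C_def)
      then have "\<theta> \<in> finite_energy" unfolding finite_energy_def by blast
      then have "coords P = \<theta>" using \<theta>(2) by (simp add: coords_realize_total)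
      then show "P \<in> coords -` K \<inter> space ?Q"
        using \<theta> by (simp add: realize_total_M1)
    next
      fix P assume "P \<in> coords -` K \<inter> space ?Q"
      then have P: "P \<in> M1" "coords P \<in> K" by auto
      then have "coords P \<in> bounded_energy (real n)" using K(1) by (auto simp: C_def)
      then have "realize_total (coords P) = P"
        using realize_coords[OF P(1)] by (auto simp: realize_total_def finite_energy_def)
      then show "P \<in> ?K" using P(2) by (metis imageI)
    qed
    moreover have K_borel: "K \<in> sets borel" using K(2) by (intro borel_closed compact_imp_closed)
    ultimately have K_sets: "?K \<in> sets ?Q" using measurable_sets[OF coords_meas K_borel] by simp
    have "measure L K \<le> measure L (realize_total -` ?K)"
      using measurable_sets[OF T, of ?K] K_sets by (intro L.finite_measure_mono) auto
    also have "\<dots> = measure ?Q ?K"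
      using measure_distr[OF T, of ?K] K_sets by simp
    finally have "measure ?Q B - e \<le> measure ?Q ?K" using n K(3) by linarith
    moreover have "?K \<subseteq> B" using K(1) by (auto simp: C_def)
    moreover have "compactin weak_topology ?K"
      by (rule compactin_realize_total[OF K(2)]) (use K(1) in \<open>auto simp: C_def\<close>)
    ultimately show ?thesis using K_sets by blast
  qed
  have "measure ?Q B = (SUP K\<in>{K. K \<subseteq> B \<and> K \<in> sets ?Q \<and> compactin weak_topology K}. measure ?Q K)"
    if B: "B \<in> sets ?Q" for B
  proof (rule antisym)
    let ?S = "{K. K \<subseteq> B \<and> K \<in> sets ?Q \<and> compactin weak_topology K}"
    have bdd: "bdd_above (measure ?Q ` ?S)"
      by (rule bdd_aboveI[of _ 1]) (auto simp: Q.prob_le_1)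
    show "measure ?Q B \<le> (SUP K\<in>?S. measure ?Q K)"
    proof (rule field_le_epsilon)
      fix e :: real assume "0 < e"
      then obtain K where "K \<in> ?S" "measure ?Q B - e \<le> measure ?Q K" using approx[OF B] by blast
      then show "measure ?Q B \<le> (SUP K\<in>?S. measure ?Q K) + e"
        using cSUP_upper[OF _ bdd, of K] by linarith
    qed
    have "{} \<in> ?S" by simp
    then show "(SUP K\<in>?S. measure ?Q K) \<le> measure ?Q B"
      using B by (intro cSUP_least) (auto intro!: Q.finite_measure_mono)
  qed
  then show ?thesis using bp by (simp add: radon_prob_on_def)
qed

end

theorem mainTheorem16:
  fixes \<U> :: "'a::{metric_space, second_countable_topology} set set"
    and A :: "bool list \<Rightarrow> 'a set"
    and \<beta> :: "bool list \<Rightarrow> real"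
  assumes "countable \<U>" and "topological_basis \<U>"
    and "dyadic_partition_tree \<U> A" and "resolves A"
    and "\<forall>\<epsilon>. \<epsilon> \<noteq> [] \<longrightarrow> \<beta> \<epsilon> > 0"
    and "\<exists>Q0. borel_prob_on tight_topology Q0 \<and> (\<forall>m\<ge>1. projects_to Q0 A \<beta> m)"
    and "bdd_above (polya_sum \<beta> ` {1..})"
  shows "(\<exists>!Q. radon_prob_on weak_topology Q \<and> (\<forall>m\<ge>1. projects_to Q A \<beta> m))
    \<and> (\<forall>Q. radon_prob_on weak_topology Q \<and> (\<forall>m\<ge>1. projects_to Q A \<beta> m) \<longrightarrow>
         (\<exists>B\<in>sets Q. B \<subseteq> {P \<in> M1. absolutely_continuous (mean_measure Q) P} \<and> measure Q B = 1))"
proof -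
  interpret dyadic_tree A
  proof
    show "A [] = UNIV" "\<And>\<epsilon>. A \<epsilon> = A (\<epsilon> @ [False]) \<union> A (\<epsilon> @ [True])"
      "\<And>\<epsilon>. A (\<epsilon> @ [False]) \<inter> A (\<epsilon> @ [True]) = {}"
      using assms(3) unfolding dyadic_partition_tree_def by blast+
    show "sigma_sets UNIV (range A) = sets borel"
      using assms(4) by (simp add: resolves_def)
  qed
  note \<beta> = assms(5)
  obtain C where C: "\<And>m. 1 \<le> m \<Longrightarrow> polya_sum \<beta> m \<le> C"
    using assms(7) by (auto simp: bdd_above_def)
  \<comment> \<open>Stated for arbitrary \<open>Q\<close>, since it is applied both to the given law
    on the tight topology and to every Radon solution, each with its own mean measure.\<close>
  have ref: "reference_tree A (mean_measure Q)"
    and AE_fin: "AE P in Q. coords P \<in> reference_tree.finite_energy A (mean_measure Q)"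
    if "random_measure Q" "\<forall>m\<ge>1. projects_to Q A \<beta> m" for Q
  proof -
    show "reference_tree A (mean_measure Q)" by (rule reference_tree_mean[OF that \<beta>])
    then show "AE P in Q. coords P \<in> reference_tree.finite_energy A (mean_measure Q)"
      using C integral_energy[OF that \<beta>] by (intro reference_tree.AE_finite_energy that(1)) auto
  qed
  have exists: "\<exists>Q. radon_prob_on weak_topology Q \<and> (\<forall>m\<ge>1. projects_to Q A \<beta> m)"
  proof -
    obtain Q0 where "borel_prob_on tight_topology Q0" and proj: "\<forall>m\<ge>1. projects_to Q0 A \<beta> m"
      using assms(6) by blast
    then have Q0: "random_measure Q0" by (intro random_measure_tight)
    interpret reference_tree A "mean_measure Q0" by (rule ref[OF Q0 proj])
    define L where "L = distr Q0 borel coords"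
    have c: "coords \<in> borel_measurable Q0" by (rule coords_measurable[OF Q0])
    have L: "prob_space L" "sets L = sets borel"
      unfolding L_def by (auto intro: prob_space.prob_space_distr random_measureD[OF Q0] c)
    have full: "AE \<theta> in L. \<theta> \<in> finite_energy"
      unfolding L_def by (subst AE_distr_iff[OF c]) (use finite_energy_borel AE_fin[OF Q0 proj] in auto)
    define Q where "Q = distr L (borel_of_top weak_topology) realize_total"
    have radon: "radon_prob_on weak_topology Q"
      unfolding Q_def by (rule radon_realize_total[OF L full])
    have T: "realize_total \<in> measurable L (borel_of_top weak_topology)"
      using measurable_realize_total by (simp add: L(2) cong: measurable_cong_sets)
    have "projects_to Q A \<beta> m" if "1 \<le> m" for m
    proof -
      let ?N = "PiM (strings m) (\<lambda>_. borel) :: (bool list \<Rightarrow> real) measure"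
      let ?p = "\<lambda>P. \<lambda>\<epsilon>\<in>strings m. measure P (A \<epsilon>)"
      let ?r = "\<lambda>\<theta>::bool list \<Rightarrow> real. restrict \<theta> (strings m)"
      have "random_measure Q"
        using radon by (intro random_measure_weak) (simp add: radon_prob_on_def)
      then have p: "?p \<in> measurable Q ?N" by (rule proj_measurable)
      then have p': "?p \<in> measurable (borel_of_top weak_topology) ?N"
        by (simp add: Q_def cong: measurable_cong_sets)
      have "(\<lambda>\<theta>. \<theta> \<epsilon>) \<in> borel_measurable L" for \<epsilon>
        using measurable_product_coordinates by (simp add: L(2) cong: measurable_cong_sets)
      then have r: "?r \<in> measurable L ?N" by (intro measurable_restrict)
      then have r': "?r \<in> measurable borel ?N" by (simp add: L(2) cong: measurable_cong_sets)
      \<comment> \<open>The histogram map after \<open>realize_total\<close> agrees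
        \<open>L\<close>-almost everywhere with restriction to level \<open>m\<close>, and
        restriction after \<open>coords\<close> is the histogram map again; so the two laws have the
        same histograms.\<close>
      have "distr Q ?N ?p = distr L ?N (?p \<circ> realize_total)"
        unfolding Q_def by (rule distr_distr[OF p' T])
      also have "\<dots> = distr L ?N ?r"
      proof (rule distr_cong_AE)
        show "AE \<theta> in L. (?p \<circ> realize_total) \<theta> = ?r \<theta>"
          using full
        proof eventually_elim
          fix \<theta> assume "\<theta> \<in> finite_energy"
          then have "coords (realize_total \<theta>) = \<theta>" by (rule coords_realize_total)
          then show "(?p \<circ> realize_total) \<theta> = ?r \<theta>"
            by (auto simp: coords_def fun_eq_iff restrict_def)
        qed
      qed (use r measurable_comp[OF T p'] in auto)
      also have "\<dots> = distr Q0 ?N (?r \<circ> coords)"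
        unfolding L_def by (rule distr_distr[OF r' c])
      also have "?r \<circ> coords = ?p" by (auto simp: coords_def fun_eq_iff restrict_def)
      finally show ?thesis using proj that unfolding projects_to_def by metis
    qed
    with radon show ?thesis by blast
  qed
  have abs: "\<exists>B\<in>sets Q. B \<subseteq> {P \<in> M1. absolutely_continuous (mean_measure Q) P} \<and> measure Q B = 1"
    if "radon_prob_on weak_topology Q" and proj: "\<forall>m\<ge>1. projects_to Q A \<beta> m" for Q
  proof -
    have Q: "random_measure Q"
      using that by (intro random_measure_weak) (simp add: radon_prob_on_def)
    interpret Q: prob_space Q by (rule random_measureD[OF Q])
    interpret reference_tree A "mean_measure Q" by (rule ref[OF Q proj])
    have sp: "space Q = M1" by (rule random_measureD[OF Q])
    \<comment> \<open>Finite energy provides a set of full measure that is visibly measurable and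
      lies inside the set of absolutely continuous measures, whose own measurability is not
      claimed.\<close>
    let ?B = "{P \<in> space Q. coords P \<in> finite_energy}"
    have B: "?B \<in> sets Q"
      using measurable_sets[OF coords_measurable[OF Q] finite_energy_borel]
      by (simp add: vimage_def Int_def conj_commute)
    have "Q.prob ?B = 1" using AE_fin[OF Q proj] B by (subst Q.prob_Collect_eq_1) auto
    moreover have "?B \<subseteq> {P \<in> M1. absolutely_continuous (mean_measure Q) P}"
      using absolutely_continuous_finite_energy sp by auto
    ultimately show ?thesis using B by blast
  qed
  show ?thesis
    using exists abs radon_unique by blast
qed

end
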